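(* For every integer $n\ge 2$, $L_n$ is a strong CR tournament.
   Context: A tournament is a digraph with exactly one arc between each pair of distinct vertices. For $n\ge2$, $L_n$ is the $n$-tournament with vertices $v_1,\dots,v_n$ such that for $1\le i<j\le n-1$, $v_i\to v_j$, and for $1\le i\le n-1$, $v_n\to v_i$ if $i$ is odd and $v_i\to v_n$ if $i$ is even. For distinct vertices write $\theta_T(u,v)=1$ if $u\to v$, $-1$ otherwise. Skew-adjacency matrix $S_T$: entry $1$ if $v_i\to v_j$, $-1$ if $v_j\to v_i$, $0$ on the diagonal; $\det(T)=\det(S_T)$. For odd $k\ge1$, $\mathcal{D}_k$ is the set of tournaments all of whose induced subtournaments have determinant at most $k^2$; $\mathcal{D}_{-1}=\emptyset$. Transitive blowup: for $T$ on $v_1,\dots,v_n$ and positive integers $a_i$, replace each $v_i$ by a transitive tournament on $a_i$ vertices, with all arcs from the $i$-th block to the $j$-th block whenever $v_i\to v_j$; a 1-transitive blowup has one $a_i=2$ and the others $1$. A diamond is a 4-tournament consisting of a 3-cycle plus a vertex dominating all of it or dominated by all of it. Two vertices $u_1,u_2$ of $T$ are covertices and revertices if $|V(T)|=2$; if $|V(T)|\ge3$ they are covertices if $\theta_T(u_1,v)=\theta_T(u_2,v)$ for all other $v$, revertices if $\theta_T(u_1,v)=-\theta_T(u_2,v)$ for all other $v$; CR-associated if covertices or revertices. For $u\notin V(T)=\{w_1,\dots,w_n\}$ and $\sigma=(r_1,\dots,r_n)\in\{\pm1\}^n$, $T(u,\sigma)$ extends $T$ by $u$ with $u\to w_i$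 iff $r_i=1$; $u$ is a CR vertex for $T$ with $\sigma$ if $u$ is CR-associated in $T(u,\sigma)$ with some vertex of $T$, otherwise a non-CR vertex. Let $T\in\mathcal{D}_k\setminus\mathcal{D}_{k-2}$, $k$ odd. $T$ is a CR tournament if $T$ is a 1-tournament, a 2-tournament or a diamond, or else for every $u\notin V(T)$ and every $\sigma$ with $u$ a non-CR vertex for $T$ with $\sigma$, $T(u,\sigma)\notin\mathcal{D}_k$. A strong CR tournament is a CR tournament all of whose 1-transitive blowups are CR tournaments. *)

theory Defs
  imports
    "Graph_Theory.Graph_Theory"
    "Jordan_Normal_Form.Determinant"
    "HOL-Library.Infinite_Typeclass"
begin

definition tournament :: "'a pair_pre_digraph \<Rightarrow> bool" where
  "tournament T \<longleftrightarrow> pair_digraph T \<and> pverts T \<noteq> {} \<and>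
     (\<forall>u \<in> pverts T. \<forall>v \<in> pverts T. u \<noteq> v \<longrightarrow>
        ((u, v) \<in> parcs T \<longleftrightarrow> (v, u) \<notin> parcs T))"

definition L_tournament :: "nat \<Rightarrow> nat pair_pre_digraph" where
  "L_tournament n = \<lparr> pverts = {1..n},
     parcs = {(i, j). 1 \<le> i \<and> i < j \<and> j \<le> n - 1}
           \<union> {(n, i) | i. 1 \<le> i \<and> i \<le> n - 1 \<and> odd i}
           \<union> {(i, n) | i. 1 \<le> i \<and> i \<le> n - 1 \<and> even i} \<rparr>"

text \<open>Only used for distinct vertices of a tournament.\<close>

definition theta :: "'a pair_pre_digraph \<Rightarrow> 'a \<Rightarrow> 'a \<Rightarrow> int" where
  "theta T u v = (if (u, v) \<in> parcs T then 1 else -1)"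

definition skew_adjacency_mat :: "'a pair_pre_digraph \<Rightarrow> 'a list \<Rightarrow> int mat" where
  "skew_adjacency_mat T vs = mat (length vs) (length vs)
     (\<lambda>(i, j). if (vs ! i, vs ! j) \<in> parcs T then 1
               else if (vs ! j, vs ! i) \<in> parcs T then -1
               else 0)"

text \<open>The determinant does not depend on the order in which the vertices are listed
  (reordering permutes rows and columns simultaneously), so any enumeration may be chosen.\<close>

definition tournament_det :: "'a pair_pre_digraph \<Rightarrow> int" where
  "tournament_det T =
     det (skew_adjacency_mat T (SOME vs. distinct vs \<and> set vs = pverts T))"

text \<open>The index is an integer so that the class with index \<open>-1\<close> makes sense; it is empty
  because of the conjunct \<open>1 \<le> k\<close>. Only odd indices are of interest.\<close>

definition det_class :: "int \<Rightarrow> 'a pair_pre_digraph set" where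
  "det_class k = {T. tournament T \<and> 1 \<le> k \<and>
     (\<forall>H. tournament H \<and> induced_subgraph (with_proj H) (with_proj T) \<longrightarrow>
        tournament_det H \<le> k\<^sup>2)}"

text \<open>Vertex \<open>(v, i)\<close> is the \<open>i\<close>-th vertex of the transitive block replacing \<open>v\<close>.\<close>

definition transitive_blowup ::
  "'a pair_pre_digraph \<Rightarrow> ('a \<Rightarrow> nat) \<Rightarrow> ('a \<times> nat) pair_pre_digraph" where
  "transitive_blowup T a = \<lparr> pverts = (SIGMA v : pverts T. {1..a v}),
     parcs = {((v, i), (w, j)). v \<in> pverts T \<and> w \<in> pverts T \<and>
                i \<in> {1..a v} \<and> j \<in> {1..a w} \<and>
                ((v, w) \<in> parcs T \<or> v = w \<and> i < j)} \<rparr>"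

definition one_transitive_blowup ::
  "'a pair_pre_digraph \<Rightarrow> ('a \<times> nat) pair_pre_digraph \<Rightarrow> bool" where
  "one_transitive_blowup T B \<longleftrightarrow>
     (\<exists>a. (\<exists>v \<in> pverts T. a v = 2 \<and> (\<forall>w \<in> pverts T - {v}. a w = 1)) \<and>
          B = transitive_blowup T a)"

definition diamond :: "'a pair_pre_digraph \<Rightarrow> bool" where
  "diamond T \<longleftrightarrow> tournament T \<and>
     (\<exists>a b c d. distinct [a, b, c, d] \<and> pverts T = {a, b, c, d} \<and>
        {(a, b), (b, c), (c, a)} \<subseteq> parcs T \<and>
        ({(d, a), (d, b), (d, c)} \<subseteq> parcs T \<or> {(a, d), (b, d), (c, d)} \<subseteq> parcs T))"

text \<open>When there are exactly two vertices, the conditions on the remaining vertices below are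
  vacuous, so the two vertices are both covertices and revertices.\<close>

definition covertices :: "'a pair_pre_digraph \<Rightarrow> 'a \<Rightarrow> 'a \<Rightarrow> bool" where
  "covertices T u1 u2 \<longleftrightarrow> u1 \<in> pverts T \<and> u2 \<in> pverts T \<and> u1 \<noteq> u2 \<and>
     (\<forall>v \<in> pverts T - {u1, u2}. theta T u1 v = theta T u2 v)"

definition revertices :: "'a pair_pre_digraph \<Rightarrow> 'a \<Rightarrow> 'a \<Rightarrow> bool" where
  "revertices T u1 u2 \<longleftrightarrow> u1 \<in> pverts T \<and> u2 \<in> pverts T \<and> u1 \<noteq> u2 \<and>
     (\<forall>v \<in> pverts T - {u1, u2}. theta T u1 v = - theta T u2 v)"

definition CR_associated :: "'a pair_pre_digraph \<Rightarrow> 'a \<Rightarrow> 'a \<Rightarrow> bool" where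
  "CR_associated T u1 u2 \<longleftrightarrow> covertices T u1 u2 \<or> revertices T u1 u2"

text \<open>The sign vector \<open>\<sigma>\<close> is indexed by the vertices of the tournament.\<close>

definition extend_tournament ::
  "'a pair_pre_digraph \<Rightarrow> 'a \<Rightarrow> ('a \<Rightarrow> int) \<Rightarrow> 'a pair_pre_digraph" where
  "extend_tournament T u \<sigma> = \<lparr> pverts = insert u (pverts T),
     parcs = parcs T \<union> {(u, w) | w. w \<in> pverts T \<and> \<sigma> w = 1}
                     \<union> {(w, u) | w. w \<in> pverts T \<and> \<sigma> w \<noteq> 1} \<rparr>"

definition CR_vertex :: "'a pair_pre_digraph \<Rightarrow> 'a \<Rightarrow> ('a \<Rightarrow> int) \<Rightarrow> bool" where
  "CR_vertex T u \<sigma> \<longleftrightarrow> (\<exists>w \<in> pverts T. CR_associated (extend_tournament T u \<sigma>) u w)"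

text \<open>The odd \<open>k\<close> with \<open>T \<in> det_class k - det_class (k - 2)\<close> is unique, since the classes are
  increasing in \<open>k\<close>. The vertex type is required to be infinite so that new vertices \<open>u\<close>
  exist and the quantification over them is not vacuous.\<close>

definition CR_tournament :: "'a::infinite pair_pre_digraph \<Rightarrow> bool" where
  "CR_tournament T \<longleftrightarrow>
     (\<exists>k. odd k \<and> 1 \<le> k \<and> T \<in> det_class k - det_class (k - 2) \<and>
        (card (pverts T) = 1 \<or> card (pverts T) = 2 \<or> diamond T \<or>
         (\<forall>u \<sigma>. u \<notin> pverts T \<and> \<sigma> \<in> pverts T \<rightarrow> {1, -1} \<and> \<not> CR_vertex T u \<sigma> \<longrightarrow>
            extend_tournament T u \<sigma> \<notin> det_class k)))"

definition strong_CR_tournament :: "'a::infinite pair_pre_digraph \<Rightarrow> bool" where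
  "strong_CR_tournament T \<longleftrightarrow>
     CR_tournament T \<and> (\<forall>B. one_transitive_blowup T B \<longrightarrow> CR_tournament B)"

end

theory Submission
  imports Defs
begin

text \<open>Determinants and CR-association are invariant under switching a vertex. Both \<open>L\<^sub>n\<close> and its
  1-transitive blowups consist of a line, i.e. a transitive tournament \<open>t\<^sub>0, \<dots>, t\<^bsub>N-1\<^esub>\<close>, and one
  apex (two for the blowup at \<open>v\<^sub>n\<close>) whose signs towards the line form a sequence \<open>x\<close>. Continued
  antiperiodically, \<open>x\<close> has \<open>k\<close> runs per period, where \<open>k\<close> is the odd one of \<open>n - 1\<close> and \<open>n - 2\<close>.
  Eliminating the line in pairs shows that the subtournament on an odd part of the line and the apex
  has as determinant the square of the alternating sum of \<open>x\<close>, so the maximum is \<open>k\<^sup>2\<close>.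

  A new vertex \<open>u\<close> adds a second antiperiodic sequence \<open>z\<close> and its sign \<open>w\<close> towards the apex. On \<open>u\<close>,
  the apex and an even part of the line the determinant is \<open>(w + G)\<^sup>2\<close>, where \<open>G\<close> is an alternating
  sum of the \<open>2 \<times> 2\<close> minors of \<open>(x, z)\<close>. If these squares are at most \<open>k\<^sup>2\<close>, then two values of \<open>G\<close>
  differ by at most \<open>2k\<close>. On one vertex from each run, dropping two neighbouring vertices in turn
  gives values that are too far apart unless \<open>z = \<plusminus>x\<close> or \<open>z\<close> changes sign only once per period;
  sets that meet one run twice extend this to the whole line. In the first case \<open>u\<close> is
  CR-associated with the apex, in the second one with a neighbour of the sign change. With two
  apexes on which \<open>u\<close> disagrees, \<open>z\<close> is replaced by \<open>z \<plusminus> 2x\<close>, whose alternating sums exceed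
  \<open>k\<close> unless \<open>z = \<plusminus>x\<close> with the opposite sign.\<close>

section \<open>Alternating sums and antiperiodic sequences\<close>

primrec alt_sum :: "('a \<Rightarrow> int) \<Rightarrow> 'a list \<Rightarrow> int" where
  "alt_sum f [] = 0"
| "alt_sum f (v # vs) = f v - alt_sum f vs"

text \<open>The sum of \<open>(-1)\<^bsup>i+j\<^esup> (z\<^sub>i x\<^sub>j - x\<^sub>i z\<^sub>j)\<close> over all positions \<open>i < j\<close>.\<close>

primrec border_sum :: "('a \<Rightarrow> int) \<Rightarrow> ('a \<Rightarrow> int) \<Rightarrow> 'a list \<Rightarrow> int" where
  "border_sum x z [] = 0"
| "border_sum x z (v # vs) = border_sum x z vs - z v * alt_sum x vs + x v * alt_sum z vs"

lemma alt_sum_map: "alt_sum f (map g L) = alt_sum (\<lambda>i. f (g i)) L"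
  by (induction L) auto

lemma border_sum_map: "border_sum x z (map g L) = border_sum (\<lambda>i. x (g i)) (\<lambda>i. z (g i)) L"
  by (induction L) (auto simp: alt_sum_map)

lemma alt_sum_cong: "(\<And>v. v \<in> set L \<Longrightarrow> f v = g v) \<Longrightarrow> alt_sum f L = alt_sum g L"
  by (induction L) auto

lemma border_sum_cong:
  assumes "\<And>v. v \<in> set L \<Longrightarrow> x v = x' v" "\<And>v. v \<in> set L \<Longrightarrow> z v = z' v"
  shows "border_sum x z L = border_sum x' z' L"
  using assms
proof (induction L)
  case (Cons v L)
  moreover have "alt_sum x L = alt_sum x' L" "alt_sum z L = alt_sum z' L"
    using Cons.prems by (auto intro: alt_sum_cong)
  ultimately show ?case by simp
qed simp

lemma alt_sum_scale: "alt_sum (\<lambda>v. c * f v) L = c * alt_sum f L"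
  by (induction L) (auto simp: algebra_simps)

lemma border_sum_scale: "border_sum (\<lambda>v. c * x v) (\<lambda>v. d * z v) L = c * d * border_sum x z L"
  by (induction L) (auto simp: algebra_simps alt_sum_scale)

lemma border_sum_same: "border_sum x x L = 0"
  by (induction L) auto

lemma alt_sum_append:
  "alt_sum f (L @ M) = alt_sum f L + (if even (length L) then 1 else -1) * alt_sum f M"
  by (induction L) auto

lemma border_sum_snoc:
  "border_sum x z (L @ [v]) =
     border_sum x z L
     + (if even (length L) then 1 else -1) * (alt_sum z L * x v - alt_sum x L * z v)"
  by (induction L) (auto simp: algebra_simps alt_sum_append)

definition sg :: "int \<Rightarrow> int" where
  "sg i = (if even i then 1 else -1)"

lemma sg_square [simp]: "sg i * sg i = 1" "sg i * (sg i * a) = a"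
  by (auto simp: sg_def)

lemma sg_cases: "sg i = 1 \<or> sg i = -1"
  by (auto simp: sg_def)

lemma sg_add: "sg (i + j) = sg i * sg j"
  by (auto simp: sg_def)

lemma sg_diff: "sg (i - j) = sg i * sg j"
  by (auto simp: sg_def)

lemma sg_odd [simp]: "odd i \<Longrightarrow> sg i = -1" and sg_even [simp]: "even i \<Longrightarrow> sg i = 1"
  by (auto simp: sg_def)

lemma alt_sum_upto:
  "a \<le> b + 1 \<Longrightarrow> alt_sum f [a..b] = sg a * (\<Sum>i = a..b. sg i * f i)"
proof (induction a b rule: upto.induct)
  case (1 i j)
  show ?case
  proof (cases "i \<le> j")
    case True
    then have "{i..j} = insert i {i+1..j}" by auto
    then have "(\<Sum>l = i..j. sg l * f l) = sg i * f i + (\<Sum>l = i+1..j. sg l * f l)" by simp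
    moreover have "alt_sum f [i+1..j] = sg (i+1) * (\<Sum>l = i+1..j. sg l * f l)"
      using 1 True by simp
    ultimately show ?thesis
      using True by (simp add: upto_rec1 sg_add algebra_simps)
  qed auto
qed

text \<open>Doubly infinite sequences that change sign after \<open>N\<close> steps encode a sign vector on
  \<open>N\<close> linearly ordered vertices up to switching: the first vertex, switched, may be moved
  behind the last one.\<close>

definition antiperiodic :: "int \<Rightarrow> (int \<Rightarrow> int) \<Rightarrow> bool" where
  "antiperiodic N f \<longleftrightarrow> (\<forall>i. f (i + N) = - f i)"

lemma antiperiodic_mult:
  assumes "antiperiodic N f"
  shows "f (i + q * N) = sg q * f i"
proof (induction q rule: int_induct[where k = 0])
  case (step1 q)
  have "f (i + (q + 1) * N) = f (i + q * N + N)" by (simp add: algebra_simps)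
  then show ?case using assms step1 by (simp add: antiperiodic_def sg_add)
next
  case (step2 q)
  have "f (i + q * N) = f (i + (q - 1) * N + N)" by (simp add: algebra_simps)
  then have "f (i + q * N) = - f (i + (q - 1) * N)"
    using assms by (simp add: antiperiodic_def)
  then show ?case using step2 by (simp add: sg_diff)
qed simp

lemma antiperiodic_minus:
  "antiperiodic N f \<Longrightarrow> f (i - N) = - f i"
  using antiperiodic_mult[of N f i "-1"] by simp

text \<open>The number \<open>w + border_sum x z L\<close> is, up to sign, the Pfaffian of the
  subtournament on the new vertex, the apex and the line vertices \<open>L\<close>. Windows may
  start anywhere, so that no later argument has to respect the ends of the line.\<close>

definition window_bounded ::
  "(int \<Rightarrow> int) \<Rightarrow> (int \<Rightarrow> int) \<Rightarrow> int \<Rightarrow> int \<Rightarrow> int \<Rightarrow> bool" where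
  "window_bounded x z w N K \<longleftrightarrow>
     (\<forall>L. sorted_wrt (<) L \<and> even (length L) \<and> (\<forall>a \<in> set L. \<forall>b \<in> set L. b < a + N) \<longrightarrow>
        \<bar>w + border_sum x z L\<bar> \<le> K)"

lemma window_boundedD:
  assumes "window_bounded x z w N K" "sorted_wrt (<) L" "even (length L)"
    "\<And>a b. a \<in> set L \<Longrightarrow> b \<in> set L \<Longrightarrow> b < a + N"
  shows "\<bar>w + border_sum x z L\<bar> \<le> K"
  using assms by (auto simp: window_bounded_def)

text \<open>The entries of \<open>M\<close> move one at a time. Moving the last of an even number of
  entries to the front keeps the parity factor of every pair. It reverses the order in the pairs of
  the moved entry, and the antiperiodic sign change makes up for that.\<close>

lemma border_sum_rotate:
  assumes "antiperiodic N x" "antiperiodic N z"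
  shows "even (length (L @ M)) \<Longrightarrow>
    border_sum x z (map (\<lambda>i. i - N) M @ L) = border_sum x z (L @ M)"
proof (induction M arbitrary: L rule: rev_induct)
  case (snoc a M)
  have "border_sum x z (map (\<lambda>i. i - N) M @ (a - N) # L) = border_sum x z ((a - N) # (L @ M))"
    using snoc.IH[of "(a - N) # L"] snoc.prems by simp
  also have "\<dots> = border_sum x z ((L @ M) @ [a])"
    unfolding border_sum_snoc using snoc.prems
    by (simp add: antiperiodic_minus[OF assms(1)] antiperiodic_minus[OF assms(2)] algebra_simps)
  finally show ?case by simp
qed simp

lemma border_sum_shift:
  assumes "antiperiodic N x" "antiperiodic N z"
  shows "border_sum x z (map (\<lambda>i. i + q * N) L) = border_sum x z L"
  by (simp add: border_sum_map antiperiodic_mult[OF assms(1)] antiperiodic_mult[OF assms(2)]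
      border_sum_scale)

text \<open>Translation by a multiple of \<open>N\<close> scales both sequences by the same sign and
  brings the first entry into \<open>{0..<N}\<close>. The entries from \<open>N\<close> on are then
  rotated to the front. Hence the subsets of the actual line control all windows.\<close>

lemma window_boundedI:
  assumes N: "0 < N" and ap: "antiperiodic N x" "antiperiodic N z"
    and bnd: "\<And>L. sorted_wrt (<) L \<Longrightarrow> even (length L) \<Longrightarrow> set L \<subseteq> {0..<N} \<Longrightarrow>
      \<bar>w + border_sum x z L\<bar> \<le> K"
  shows "window_bounded x z w N K"
  unfolding window_bounded_def
proof (intro allI impI, elim conjE)
  fix L :: "int list"
  assume L: "sorted_wrt (<) L" "even (length L)" "\<forall>a \<in> set L. \<forall>b \<in> set L. b < a + N"
  show "\<bar>w + border_sum x z L\<bar> \<le> K"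
  proof (cases L)
    case Nil
    then show ?thesis using bnd[of "[]"] by simp
  next
    case (Cons h T)
    define q where "q = h div N"
    define L' where "L' = map (\<lambda>i. i + (- q) * N) L"
    have h: "0 \<le> h - q * N" "h - q * N < N"
      using N by (simp_all add: q_def minus_div_mult_eq_mod)
    have "h \<le> a" if "a \<in> set L" for a
      using L(1) that Cons by auto
    moreover have "a < h + N" if "a \<in> set L" for a
      using L(3) that Cons by auto
    ultimately have L'set: "0 \<le> a" "a < 2 * N" "h - q * N \<le> a" "a < h - q * N + N"
      if "a \<in> set L'" for a
      using that h by (force simp: L'_def)+
    have L'sorted: "sorted_wrt (<) L'"
      using L(1) by (simp add: L'_def sorted_wrt_map)
    define L1 where "L1 = filter (\<lambda>a. a < N) L'"
    define L2 where "L2 = filter (\<lambda>a. \<not> a < N) L'"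
    have L12: "L' = L1 @ L2"
      using L'sorted unfolding L1_def L2_def
    proof (induction L')
      case (Cons a xs)
      show ?case
      proof (cases "a < N")
        case False
        then have "\<not> b < N" if "b \<in> set xs" for b
          using Cons.prems that by force
        then have "filter (\<lambda>a. a < N) xs = []" "filter (\<lambda>a. \<not> a < N) xs = xs"
          by (auto simp: filter_empty_conv filter_id_conv)
        then show ?thesis using False by simp
      qed (use Cons in simp)
    qed simp
    define M where "M = map (\<lambda>i. i - N) L2 @ L1"
    have "a - N < b" if "a \<in> set L2" "b \<in> set L1" for a b
    proof -
      have "a \<in> set L'" "b \<in> set L'" using that by (simp_all add: L1_def L2_def)
      then show ?thesis using L'set(4)[of a] L'set(3)[of b] by linarith
    qed
    moreover have "sorted_wrt (<) L1" "sorted_wrt (<) L2"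
      using L'sorted by (simp_all add: L12 sorted_wrt_append)
    ultimately have "sorted_wrt (<) M"
      by (auto simp: M_def sorted_wrt_append sorted_wrt_map)
    moreover have len: "length (L1 @ L2) = length L"
      using L12 by (metis L'_def length_map)
    then have "even (length M)"
      using L(2) by (simp add: M_def add.commute)
    moreover have "set M \<subseteq> {0..<N}"
      using L'set by (auto simp: M_def L1_def L2_def)
    ultimately have "\<bar>w + border_sum x z M\<bar> \<le> K" by (rule bnd)
    moreover have "border_sum x z M = border_sum x z L"
    proof -
      have "border_sum x z M = border_sum x z (L1 @ L2)"
        unfolding M_def by (rule border_sum_rotate[OF ap]) (use len L(2) in simp)
      also have "\<dots> = border_sum x z L"
        unfolding L12[symmetric] L'_def by (rule border_sum_shift[OF ap])
      finally show ?thesis .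
    qed
    ultimately show ?thesis by simp
  qed
qed

text \<open>This is restriction to a part of the line: \<open>g\<close> enumerates a choice of
  \<open>m\<close> vertices per period and maps windows to windows.\<close>

lemma window_bounded_comp:
  assumes "window_bounded x z w N K" "strict_mono g" "\<And>i. g (i + m) = g i + N"
  shows "window_bounded (\<lambda>i. x (g i)) (\<lambda>i. z (g i)) w m K"
  unfolding window_bounded_def
proof (intro allI impI, elim conjE)
  fix L :: "int list"
  assume L: "sorted_wrt (<) L" "even (length L)" "\<forall>a \<in> set L. \<forall>b \<in> set L. b < a + m"
  have "\<bar>w + border_sum x z (map g L)\<bar> \<le> K"
  proof (rule window_boundedD[OF assms(1)])
    show "sorted_wrt (<) (map g L)"
      using L(1) assms(2) by (simp add: sorted_wrt_map strict_mono_less)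
    fix a b assume "a \<in> set (map g L)" "b \<in> set (map g L)"
    then show "b < a + N"
      using L(3) assms(2) by (auto simp flip: assms(3) simp: strict_mono_less)
  qed (use L in simp)
  then show "\<bar>w + border_sum (\<lambda>i. x (g i)) (\<lambda>i. z (g i)) L\<bar> \<le> K"
    by (simp add: border_sum_map)
qed

section \<open>Sums over one period and border sums over its punctured windows\<close>

lemma periodic_sum:
  fixes f :: "int \<Rightarrow> int"
  assumes "\<And>i. f (i + m) = f i" "0 \<le> m"
  shows "sum f {a..<a + m} = sum f {0..<m}"
proof -
  have step: "sum f {a+1..<a+1+m} = sum f {a..<a+m}" for a
  proof -
    have "insert a {a+1..<a+1+m} = insert (a+m) {a..<a+m}"
      using assms(2) by auto
    moreover have "sum f (insert a {a+1..<a+1+m}) = f a + sum f {a+1..<a+1+m}"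
      "sum f (insert (a+m) {a..<a+m}) = f (a+m) + sum f {a..<a+m}"
      by (subst sum.insert; simp)+
    ultimately show ?thesis using assms(1) by simp
  qed
  show ?thesis
  proof (induction a rule: int_induct[where k = 0])
    case (step2 a)
    then show ?case using step[of "a - 1"] by simp
  qed (use step in simp_all)
qed

text \<open>Consecutive complements of a single point differ by exchanging one end vertex for
  another, which gives a closed formula for the change of the border sum.\<close>

lemma border_sum_step:
  assumes m: "odd m" "3 \<le> m" and ap: "antiperiodic m z"
  defines "y \<equiv> \<lambda>i. sg i * z i"
  shows "border_sum sg z [j+2..j+m] - border_sum sg z [j+1..j+m-1]
         = 2 * (\<Sum>i = 0..<m. y i) - m * (y j + y (j+1))"
proof -
  define R where "R = [j+2..j+m-1]"
  have len: "odd (length R)" using m by (simp add: R_def even_nat_iff)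
  have per: "y (i + m) = y i" for i
    using ap m by (simp add: y_def antiperiodic_def sg_add)
  have sgm: "sg (i + m) = - sg i" for i using m by (simp add: sg_add)
  have aR: "alt_sum f R = sg j * (\<Sum>i = j+2..j+m-1. sg i * f i)" for f
    using m by (simp add: R_def alt_sum_upto sg_add)
  have "{j..<j+m} = insert j (insert (j+1) {j+2..j+m-1})" using m by auto
  then have "(\<Sum>i = j..<j+m. y i) = y j + y (j+1) + (\<Sum>i = j+2..j+m-1. y i)"
    by simp
  moreover have "(\<Sum>i = j..<j+m. y i) = (\<Sum>i = 0..<m. y i)"
    using periodic_sum[of y m j] per m by simp
  ultimately have az: "alt_sum z R = sg j * ((\<Sum>i = 0..<m. y i) - y j - y (j+1))"
    using aR[of z] by (simp add: y_def)
  have ax: "alt_sum sg R = sg j * (m - 2)"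
    using aR[of sg] m by simp
  have zz: "z i = sg i * y i" for i by (simp add: y_def)
  have l1: "[j+2..j+m] = R @ [j+m]"
    using m by (simp add: R_def upto_rec2[of "j+2" "j+m"])
  have l2: "[j+1..j+m-1] = (j+1) # R"
    using m by (simp add: R_def upto_rec1[of "j+1"] add.assoc)
  have "z (j + m) = - z j" using ap by (simp add: antiperiodic_def)
  then show ?thesis
    unfolding l1 l2 border_sum_snoc border_sum.simps using len m(1) per[of j]
    by (simp add: az ax zz sgm sg_add algebra_simps)
qed

text \<open>Taking differences removes the unknown \<open>w\<close> at the price of doubling the
  bound.\<close>

lemma border_sum_diff_bounded:
  assumes bnd: "window_bounded sg z w m K" and m: "0 < m" "odd m"
  shows "\<bar>border_sum sg z [i+1..i+m-1] - border_sum sg z [j+1..j+m-1]\<bar> \<le> 2 * K"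
proof -
  have "\<bar>w + border_sum sg z [i+1..i+m-1]\<bar> \<le> K" for i
    by (rule window_boundedD[OF bnd])
      (use m in \<open>auto simp: even_nat_iff\<close>)
  from this[of i] this[of j] show ?thesis by linarith
qed

section \<open>Sequences with alternating apex signs\<close>

lemma odd_sum_odd:
  fixes f :: "'a \<Rightarrow> int"
  assumes "finite A" "\<And>i. i \<in> A \<Longrightarrow> odd (f i)" "odd (card A)"
  shows "odd (sum f A)"
proof -
  have "even (sum f A) = even (card A)"
    using assms(1,2) by (induction A rule: finite_induct) auto
  then show ?thesis using assms(3) by simp
qed

lemma strict_mono_int_stepI:
  fixes g :: "int \<Rightarrow> int"
  assumes "\<And>i. g i < g (i + 1)"
  shows "strict_mono g"
proof (rule strict_monoI)
  fix i j :: int assume "i < j"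
  then show "g i < g j"
    by (induction j rule: int_gr_induct) (use assms in \<open>auto intro: less_trans\<close>)
qed

lemma mono_int_stepI:
  fixes g :: "int \<Rightarrow> int"
  assumes "\<And>i. g i \<le> g (i + 1)"
  shows "mono g"
proof (rule monoI)
  fix i j :: int assume "i \<le> j"
  then show "g i \<le> g j"
    by (induction j rule: int_ge_induct) (use assms in \<open>auto intro: order_trans\<close>)
qed

section \<open>Quasiperiodic extensions of maps given on one window\<close>

text \<open>The extension of \<open>f\<close>, given on the window \<open>[a, a + m)\<close>, that grows by \<open>N\<close> per period \<open>m\<close>.\<close>

definition quasi_ext :: "int \<Rightarrow> int \<Rightarrow> int \<Rightarrow> (int \<Rightarrow> int) \<Rightarrow> int \<Rightarrow> int" where
  "quasi_ext a m N f i = f (a + (i - a) mod m) + N * ((i - a) div m)"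

lemma quasi_ext_window: "a \<le> i \<Longrightarrow> i < a + m \<Longrightarrow> quasi_ext a m N f i = f i"
  by (simp add: quasi_ext_def)

lemma quasi_ext_add:
  assumes "0 < m"
  shows "quasi_ext a m N f (i + m) = quasi_ext a m N f i + N"
proof -
  have "i + m - a = (i - a) + m" by simp
  then have "(i + m - a) mod m = (i - a) mod m" "(i + m - a) div m = (i - a) div m + 1"
    using assms by (simp_all only: mod_add_self2 div_add_self2)
  then show ?thesis by (simp add: quasi_ext_def algebra_simps)
qed

text \<open>A step either stays inside a translate of the window or crosses the seam between two
  translates, so conditions on steps need checking only there.\<close>

lemma quasi_ext_step:
  assumes "0 < m"
  obtains s q where "a \<le> s" "s + 1 < a + m" "quasi_ext a m N f i = f s + N * q"
      "quasi_ext a m N f (i + 1) = f (s + 1) + N * q"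
  | q where "quasi_ext a m N f i = f (a + m - 1) + N * q"
      "quasi_ext a m N f (i + 1) = f a + N * q + N"
proof -
  define s q where "s = (i - a) mod m" and "q = (i - a) div m"
  have s: "0 \<le> s" "s < m" using assms by (simp_all add: s_def)
  have i: "i - a = s + q * m" by (simp add: s_def q_def)
  then have i1: "i + 1 - a = (s + 1) + q * m" by simp
  show thesis
  proof (cases "s + 1 < m")
    case True
    then have "(i + 1 - a) mod m = s + 1" "(i + 1 - a) div m = q"
      unfolding i1 using s by simp_all
    then show thesis using that(1)[of "a + s" q] s True
      by (simp add: quasi_ext_def add.assoc flip: s_def q_def)
  next
    case False
    then have "s + 1 = m" using s by simp
    then have "i + 1 - a = (q + 1) * m" using i1 by (simp add: algebra_simps)
    then have "(i + 1 - a) mod m = 0" "(i + 1 - a) div m = q + 1"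
      using assms by simp_all
    moreover have "(i - a) mod m = m - 1"
      using \<open>s + 1 = m\<close> by (simp add: s_def)
    ultimately have "quasi_ext a m N f i = f (a + m - 1) + N * q"
      "quasi_ext a m N f (i + 1) = f a + N * q + N"
      unfolding quasi_ext_def by (simp_all add: add_diff_eq distrib_left flip: q_def)
    then show thesis by (rule that(2))
  qed
qed

section \<open>The dichotomy for sign sequences against an alternating apex\<close>

lemma window_bounded_uminus:
  assumes "window_bounded x z w N K"
  shows "window_bounded x (\<lambda>i. - z i) (- w) N K"
proof -
  have "\<bar>- w + border_sum x (\<lambda>i. - z i) L\<bar> = \<bar>w + border_sum x z L\<bar>" for L
  proof -
    have "border_sum x (\<lambda>i. - z i) L = - border_sum x z L"
      using border_sum_scale[of 1 x "-1" z L] by simp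
    then show ?thesis by simp
  qed
  then show ?thesis using assms by (simp add: window_bounded_def)
qed

text \<open>The signs \<open>y i = sg i * z i\<close> have period \<open>k\<close>, and
  \<open>E (j+1) - E j\<close> depends only on their sum \<open>Y\<close> and on
  \<open>y j + y (j+1)\<close>. As \<open>E\<close> varies by at most \<open>2 * k\<close>, entries
  -1 are isolated, three consecutive entries 1 are impossible, and finally \<open>Y = 1\<close>. So
  \<open>y\<close> alternates except at one place per period, which makes \<open>z\<close> constant
  for one period.\<close>

lemma sign_sequence_positive_case:
  assumes k: "odd k" "0 < k" and ap: "antiperiodic k z" and z: "\<And>i. z i \<in> {1, -1}"
    and bnd: "window_bounded sg z w k k"
    and Y0: "0 < (\<Sum>i = 0..<k. sg i * z i)"
  shows "(\<forall>i. sg i * z i = 1) \<or> (\<exists>j. \<forall>i \<in> {j+1..j+k}. z i = z (j+1))"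
proof (cases "\<forall>i. sg i * z i = 1")
  case False
  define y where "y \<equiv> \<lambda>i. sg i * z i"
  define Y where "Y = (\<Sum>i = 0..<k. y i)"
  define E where "E j = border_sum sg z [j+1..j+k-1]" for j
  have y: "y i = 1 \<or> y i = -1" for i
    using z[of i] sg_cases[of i] by (auto simp: y_def)
  have zy: "z i = sg i * y i" for i by (simp add: y_def)
  have per: "y (i + k) = y i" for i
    using ap k by (simp add: y_def antiperiodic_def sg_add)
  have per': "y (i - k) = y i" for i
    using per[of "i - k"] by simp
  have Yw: "(\<Sum>i = j..<j+k. y i) = Y" for j
    using periodic_sum[of y k j] per k by (simp add: Y_def)
  have oddy: "odd (y i)" for i using y[of i] by auto
  have oddY: "odd Y"
    unfolding Y_def by (rule odd_sum_odd) (use k in \<open>auto simp: even_nat_iff oddy\<close>)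
  have Ypos: "0 < Y" using Y0 by (simp add: Y_def y_def)
  obtain p where p: "y p = -1" using False y by (auto simp: y_def)
  have k3: "3 \<le> k"
  proof (rule ccontr)
    assume "\<not> 3 \<le> k"
    then have "k = 1" using k by presburger
    moreover have "{p..<p+1} = {p}" by auto
    ultimately have "Y = y p" using Yw[of p] by simp
    then show False using p Ypos by simp
  qed
  have step: "E (j+1) - E j = 2 * Y - k * (y j + y (j+1))" for j
    using border_sum_step[OF k(1) k3 ap, of j] unfolding E_def Y_def y_def
    by (simp add: add.assoc)
  have Ediff: "\<bar>E i - E j\<bar> \<le> 2 * k" for i j
    unfolding E_def by (rule border_sum_diff_bounded[OF bnd k(2,1)])
  have isolated: "y (j+1) = 1" if "y j = -1" for j
  proof (rule ccontr)
    assume "y (j+1) \<noteq> 1"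
    then have "y (j+1) = -1" using y by blast
    then have "E (j+1) - E j = 2 * Y + 2 * k" using step[of j] that by simp
    then show False using Ediff[of "j+1" j] Ypos by simp
  qed
  have isolated': "y (j-1) = 1" if "y j = -1" for j
    using isolated[of "j-1"] y[of "j-1"] that by auto
  \<comment> \<open>Both neighbours of the entry -1 at \<open>p\<close> are 1, so the terms with
    factor \<open>k\<close> vanish in the two steps across \<open>p\<close>. Equality is excluded
    because \<open>k\<close> is odd.\<close>
  have Yk: "2 * Y < k"
  proof -
    have "E (p+1) - E (p-1) = 4 * Y"
      using step[of "p-1"] step[of p] p isolated[OF p] isolated'[OF p] by simp
    then have "2 * Y \<le> k" using Ediff[of "p+1" "p-1"] by simp
    then show ?thesis using k(1) by presburger
  qed
  have no111: "y (j+2) = -1" if "y j = 1" "y (j+1) = 1" for j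
  proof (rule ccontr)
    assume "y (j+2) \<noteq> -1"
    then have "y (j+2) = 1" using y by blast
    then have "E (j+2) - E j = 4 * Y - 4 * k"
      using step[of j] step[of "j+1"] that by (simp add: add.assoc)
    then show False using Ediff[of "j+2" j] Yk by simp
  qed
  have pairs: "(\<Sum>i = a..<a+k. y i + y (i+1)) = 2 * Y" for a
  proof -
    have "(\<Sum>i = a..<a+k. y (i+1)) = (\<Sum>i = a+1..<a+1+k. y i)"
      by (rule sum.reindex_bij_witness[of _ "\<lambda>i. i - 1" "\<lambda>i. i + 1"]) auto
    then show ?thesis using Yw[of a] Yw[of "a+1"] by (simp add: sum.distrib)
  qed
  have nonneg: "0 \<le> y i + y (i+1)" for i
    using y[of i] y[of "i+1"] isolated[of i] by auto
  obtain j where j: "y j = 1" "y (j+1) = 1"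
  proof -
    have "\<exists>i \<in> {0..<k}. 0 < y i + y (i+1)"
    proof (rule ccontr)
      assume "\<not> ?thesis"
      then have "(\<Sum>i = 0..<0+k. y i + y (i+1)) \<le> 0"
        by (intro sum_nonpos) (auto simp: not_less)
      then show False using pairs[of 0] Ypos by simp
    qed
    then obtain i where "0 < y i + y (i+1)" by blast
    then have "y i = 1 \<and> y (i+1) = 1" using y[of i] y[of "i+1"] by auto
    then show thesis using that by blast
  qed
  have "Y < 3"
  proof (rule ccontr)
    assume "\<not> Y < 3"
    then have Y3: "3 \<le> Y" by simp
    txt \<open>Around \<open>j\<close>, \<open>y\<close> reads \<open>1, -1, 1, 1, -1, 1\<close>. Without the two inner entries it becomes
      \<open>1, -1, -1, 1\<close>, and three steps across these entries change \<open>E\<close> by more than \<open>2k\<close>.\<close>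
    define m where "m = k - 2"
    have m: "odd m" "3 \<le> m" using k Yk Y3 by (auto simp: m_def)
    define g where "g = quasi_ext (j+2) m k (\<lambda>i. i)"
    have gadd: "g (i + m) = g i + k" for i
      using m by (simp add: g_def quasi_ext_add)
    have gwin: "g i = i" if "j + 2 \<le> i" "i < j + k" for i
      unfolding g_def by (rule quasi_ext_window) (use that in \<open>auto simp: m_def\<close>)
    have gmono: "strict_mono g"
    proof (rule strict_mono_int_stepI)
      fix i show "g i < g (i + 1)"
        unfolding g_def
        by (rule quasi_ext_step[of m "j+2" k "\<lambda>i. i" i]) (use m in \<open>auto simp: m_def\<close>)
    qed
    \<comment> \<open>Each period crossed skips two positions, so \<open>g\<close> preserves parity
      and the apex signs still alternate.\<close>
    have sgg: "sg (g i) = sg i" for i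
    proof -
      have "g i = i + 2 * ((i - (j+2)) div m)"
        using div_mult_mod_eq[of "i - (j+2)" m]
        by (simp add: g_def quasi_ext_def m_def algebra_simps)
      then show ?thesis by (simp add: sg_def)
    qed
    have bnd': "window_bounded sg (\<lambda>i. z (g i)) w m k"
      using window_bounded_comp[OF bnd gmono gadd] by (simp add: sgg)
    have ap': "antiperiodic m (\<lambda>i. z (g i))"
      using ap by (simp add: antiperiodic_def gadd)
    define y' where "y' i = y (g i)" for i
    have y': "y' i = sg i * z (g i)" for i by (simp add: y'_def y_def sgg)
    have y'per: "y' (i + m) = y' i" for i by (simp add: y'_def gadd per)
    have "{j..<j+k} = insert j (insert (j+1) {j+2..<j+2+m})"
      using m by (auto simp: m_def)
    then have "Y = 2 + (\<Sum>i = j+2..<j+2+m. y i)"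
      using Yw[of j] j by simp
    also have "(\<Sum>i = j+2..<j+2+m. y i) = (\<Sum>i = j+2..<j+2+m. y' i)"
      by (rule sum.cong) (auto simp: y'_def gwin m_def)
    also have "\<dots> = (\<Sum>i = 0..<m. y' i)"
      using periodic_sum[of y' m "j+2"] y'per m by simp
    finally have Y': "(\<Sum>i = 0..<m. sg i * z (g i)) = Y - 2" by (simp add: y')
    define E' where "E' i = border_sum sg (\<lambda>i. z (g i)) [i+1..i+m-1]" for i
    have step': "E' (i+1) - E' i = 2 * (Y - 2) - m * (y' i + y' (i+1))" for i
      using border_sum_step[OF m ap', of i] unfolding E'_def Y' y' by (simp add: add.assoc)
    have jm: "y (j-1) = -1"
      using no111[of "j-1"] j y[of "j-1"] by (auto simp: add.commute)
    have jp: "y (j+2) = -1" using no111[OF j] .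
    have "y' (j+2) = -1" "y' (j+3) = 1"
      using jp isolated[OF jp] m by (simp_all add: y'_def gwin m_def add.assoc)
    then have "y' (j+2+m) = -1" "y' (j+3+m) = 1" by (simp_all add: y'per)
    moreover have "y' (j+1+m) = -1" "y' (j+m) = 1"
    proof -
      have "g (j+1+m) = j - 1 + k" "g (j+m) = j - 1 - 1 + k"
        using gwin[of "j+1+m"] gwin[of "j+m"] m by (auto simp: m_def)
      then show "y' (j+1+m) = -1" "y' (j+m) = 1"
        using jm isolated'[OF jm] by (simp_all only: y'_def per)
    qed
    \<comment> \<open>From \<open>j + m\<close> on, \<open>y'\<close> reads 1, -1, -1, 1, with
      neighbour sums 0, -2, 0. For \<open>m = k - 2\<close> and \<open>Y >= 3\<close> the change is
      at least \<open>2 * k + 2\<close>.\<close>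
    ultimately have "E' (j+m+3) - E' (j+m) = 6 * (Y - 2) + 2 * m"
      using step'[of "j+m"] step'[of "j+m+1"] step'[of "j+m+2"]
      by (simp add: algebra_simps)
    moreover have "\<bar>E' (j+m+3) - E' (j+m)\<bar> \<le> 2 * k"
      unfolding E'_def by (rule border_sum_diff_bounded[OF bnd']) (use m in auto)
    ultimately show False using Y3 by (simp add: m_def)
  qed
  then have Y1: "Y = 1" using oddY Ypos by presburger
  \<comment> \<open>The neighbour sums of one period are nonnegative with total
    \<open>2 * Y = 2\<close>, and the one at \<open>j\<close> already equals 2.\<close>
  have alternate: "y (i+1) = - y i" if "j + 1 \<le> i" "i < j + k" for i
  proof -
    have "{j..<j+k} = insert j {j+1..<j+k}" using k by auto
    then have "(\<Sum>i = j+1..<j+k. y i + y (i+1)) = 0"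
      using pairs[of j] j Y1 by simp
    moreover have "(\<Sum>i = j+1..<j+k. y i + y (i+1)) = 0 \<longleftrightarrow> (\<forall>i\<in>{j+1..<j+k}. y i + y (i+1) = 0)"
      by (rule sum_nonneg_eq_0_iff) (use nonneg in auto)
    ultimately have "y i + y (i+1) = 0" using that by auto
    then show ?thesis by simp
  qed
  have const: "z i = z (j+1)" if "j + 1 \<le> i" "i \<le> j + k" for i
    using that
  proof (induction i rule: int_ge_induct)
    case (step i)
    then show ?case using alternate[of i] by (simp add: zy sg_add)
  qed simp
  show ?thesis
  proof (intro disjI2 exI[of _ j] ballI)
    show "z i = z (j+1)" if "i \<in> {j+1..j+k}" for i using const[of i] that by simp
  qed
qed (rule disjI1)

text \<open>The weighted sum \<open>Y\<close> has an odd number of odd terms and so is not 0.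
  Negating \<open>z\<close> and \<open>w\<close> reduces \<open>Y < 0\<close> to
  \<open>0 < Y\<close>.\<close>

lemma sign_sequence_dichotomy_aux:
  assumes k: "odd k" "0 < k" and ap: "antiperiodic k z" and z: "\<And>i. z i \<in> {1, -1}"
    and bnd: "window_bounded sg z w k k"
  obtains c where "c \<in> {1, -1}" "\<And>i. z i = c * sg i"
  | j c where "c \<in> {1, -1}" "\<And>i. j + 1 \<le> i \<Longrightarrow> i \<le> j + k \<Longrightarrow> z i = c"
proof -
  define Y where "Y = (\<Sum>i = 0..<k. sg i * z i)"
  have "odd Y" unfolding Y_def
  proof (rule odd_sum_odd)
    show "odd (sg i * z i)" for i using z[of i] sg_cases[of i] by auto
  qed (use k in \<open>auto simp: even_nat_iff\<close>)
  then have "Y \<noteq> 0" by auto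
  then consider "0 < Y" | "Y < 0" by linarith
  then show thesis
  proof cases
    case 1
    with sign_sequence_positive_case[OF k ap z bnd] consider
      "\<And>i. sg i * z i = 1" | j where "\<And>i. i \<in> {j+1..j+k} \<Longrightarrow> z i = z (j+1)"
      unfolding Y_def by blast
    then show thesis
    proof cases
      case 1
      have "z i = 1 * sg i" for i
        using sg_square(2)[of i "z i"] 1[of i] by simp
      then show thesis using that(1)[of 1] by simp
    next
      case (2 j)
      show thesis
      proof (rule that(2)[of "z (j+1)" j])
        show "z i = z (j+1)" if "j + 1 \<le> i" "i \<le> j + k" for i using 2[of i] that by simp
      qed (rule z)
    qed
  next
    case 2
    have "window_bounded sg (\<lambda>i. - z i) (- w) k k"
      using bnd by (rule window_bounded_uminus)
    moreover have "0 < (\<Sum>i = 0..<k. sg i * - z i)"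
      using 2 by (simp add: Y_def sum_negf)
    moreover have "antiperiodic k (\<lambda>i. - z i)" using ap by (simp add: antiperiodic_def)
    moreover have "- z i \<in> {1, -1}" for i using z[of i] by auto
    ultimately consider
      "\<And>i. sg i * - z i = 1" | j where "\<And>i. i \<in> {j+1..j+k} \<Longrightarrow> - z i = - z (j+1)"
      using sign_sequence_positive_case[of k "\<lambda>i. - z i" "- w"] k by blast
    then show thesis
    proof cases
      case 1
      have "z i = (-1) * sg i" for i
        using 1[of i] sg_cases[of i] by auto
      then show thesis using that(1)[of "-1"] by simp
    next
      case (2 j)
      show thesis
      proof (rule that(2)[of "z (j+1)" j])
        show "z i = z (j+1)" if "j + 1 \<le> i" "i \<le> j + k" for i using 2[of i] that by simp
      qed (rule z)
    qed
  qed
qed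

text \<open>Translation by whole periods moves the sign change into a prescribed period;
  \<open>r\<close> is left free so that it can be a run under consideration.\<close>

lemma sign_sequence_dichotomy:
  assumes k: "odd k" "0 < k" and ap: "antiperiodic k z" and z: "\<And>i. z i \<in> {1, -1}"
    and bnd: "window_bounded sg z w k k"
  obtains c where "c \<in> {1, -1}" "\<And>i. z i = c * sg i"
  | j c where "r \<le> j" "j < r + k" "c \<in> {1, -1}"
      "\<And>i. j + 1 \<le> i \<Longrightarrow> i \<le> j + k \<Longrightarrow> z i = c"
proof (rule sign_sequence_dichotomy_aux[OF assms])
  fix j c assume c: "c \<in> {1, -1}" and const: "\<And>i. j + 1 \<le> i \<Longrightarrow> i \<le> j + k \<Longrightarrow> z i = c"
  define q where "q = (j - r) div k"
  have jq: "j - q * k = r + (j - r) mod k"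
  proof -
    have "q * k + (j - r) mod k = j - r" unfolding q_def by (rule div_mult_mod_eq)
    then show ?thesis by linarith
  qed
  show thesis
  proof (rule that(2)[of "j - q * k" "sg q * c"])
    show "r \<le> j - q * k" "j - q * k < r + k" using k by (simp_all add: jq)
    show "sg q * c \<in> {1, -1}" using c sg_cases[of q] by auto
    fix i assume "j - q * k + 1 \<le> i" "i \<le> j - q * k + k"
    then have "z (i + q * k) = c" by (intro const) auto
    then show "z i = sg q * c"
      using antiperiodic_mult[OF ap, of i q] by auto
  qed
qed (rule that(1))

section \<open>Runs of equal apex signs\<close>

text \<open>Against \<open>sg\<close>, the pair \<open>i < j\<close> contributes
  \<open>sg i * z i - sg j * z j\<close>. Thus the weight of an entry is the number of later entries
  minus the number of earlier ones.\<close>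

lemma border_sum_upto:
  "border_sum sg z [a..c] = (\<Sum>i = a..c. (a + c - 2 * i) * (sg i * z i))"
proof (induction a c rule: upto.induct)
  case (1 i j)
  show ?case
  proof (cases "i \<le> j")
    case True
    then have ins: "{i..j} = insert i {i+1..j}" by auto
    define A where "A = (\<Sum>l = i+1..j. sg l * z l)"
    define B where "B = (\<Sum>l = i+1..j. (i + j - 2 * l) * (sg l * z l))"
    have "(i + 1 + j - 2 * l) * (sg l * z l) = (i + j - 2 * l) * (sg l * z l) + sg l * z l" for l
      by (simp add: algebra_simps)
    then have "border_sum sg z [i+1..j] = B + A"
      using 1 True by (simp add: A_def B_def sum.distrib)
    moreover have "alt_sum sg [i+1..j] = - sg i * (j - i)" "alt_sum z [i+1..j] = - sg i * A"
      using True by (simp_all add: alt_sum_upto sg_add A_def)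
    ultimately have "border_sum sg z [i..j] = (j - i) * (sg i * z i) + B"
      unfolding upto_rec1[OF True] by (simp only: border_sum.simps) (simp add: algebra_simps)
    then show ?thesis unfolding ins by (simp add: B_def)
  qed simp
qed

text \<open>The weights are those of \<open>border_sum_upto\<close> on \<open>[r..r+k]\<close>. This
  and the next sum evaluate the inner terms for the two shapes that the dichotomy allows.\<close>

lemma sum_weighted_constant: "(\<Sum>i = r+1..r+int n. 2*r + k - 2*i) = int n * (k - int n - 1)"
proof (induction n)
  case (Suc n)
  have "{r+1..r+int (Suc n)} = insert (r + int n + 1) {r+1..r+int n}" by auto
  then show ?case using Suc by (simp add: algebra_simps)
qed simp

lemma sum_weighted_alternating:
  "(\<Sum>i = r+1..r+int n. (2*r + k - 2*i) * sg i)
     = sg r * (if even n then - int n else int n + 1 - k)"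
proof (induction n)
  case (Suc n)
  have "{r+1..r+int (Suc n)} = insert (r + int n + 1) {r+1..r+int n}" by auto
  then show ?case using Suc by (auto simp: sg_add algebra_simps)
qed simp

text \<open>Vertex \<open>i\<close> of the line has sign \<open>sg (rho i)\<close>, so \<open>rho\<close> numbers the maximal runs of
  equal signs; a period of \<open>N\<close> vertices meets \<open>k\<close> runs.\<close>

locale run_numbering =
  fixes N k :: int and rho :: "int \<Rightarrow> int"
  assumes k: "odd k" "0 < k" and N: "0 < N"
    and rho_step: "rho (i + 1) = rho i \<or> rho (i + 1) = rho i + 1"
    and rho_period: "rho (i + N) = rho i + k"
begin

lemma rho_mono: "mono rho"
  by (rule mono_int_stepI) (use rho_step in \<open>smt (verit)\<close>)

lemma rho_le: "i \<le> j \<Longrightarrow> rho i \<le> rho j"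
  using rho_mono by (rule monoD)

lemma rho_less: "rho i < rho j \<Longrightarrow> i < j"
  using rho_le[of j i] by linarith

lemma rho_shift: "rho (i + q * N) = rho i + q * k"
proof (induction q rule: int_induct[where k = 0])
  case (step1 q)
  then show ?case using rho_period[of "i + q * N"] by (simp add: algebra_simps)
next
  case (step2 q)
  then show ?case using rho_period[of "i + (q - 1) * N"] by (simp add: algebra_simps)
qed simp

lemma rho_intermediate:
  assumes "a \<le> b" "rho a \<le> r" "r \<le> rho b"
  shows "\<exists>i. a \<le> i \<and> i \<le> b \<and> rho i = r"
  using assms
proof (induction b rule: int_ge_induct)
  case (step b)
  show ?case
  proof (cases "r \<le> rho b")
    case True
    then show ?thesis using step by force
  next
    case False
    then have "rho (b + 1) = r" using rho_step[of b] step.prems by auto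
    then show ?thesis using step.hyps by (intro exI[of _ "b + 1"]) simp
  qed
qed auto

lemma rho_surj: "\<exists>i. rho i = r"
proof -
  define q where "q = \<bar>r\<bar> + \<bar>rho 0\<bar>"
  have q: "0 \<le> q" by (simp add: q_def)
  have "q * 1 \<le> q * k" using k q by (intro mult_left_mono) auto
  then have "rho (0 + q * N) \<ge> r" "- (q * k) \<le> r - rho 0"
    using q_def unfolding rho_shift by linarith+
  moreover from this have "rho (0 + (- q) * N) \<le> r"
    unfolding rho_shift by simp
  moreover have "0 + (- q) * N \<le> 0 + q * N" using N q by simp
  ultimately show ?thesis using rho_intermediate by blast
qed

lemma antiperiodic_sign: "antiperiodic N (\<lambda>i. sg (rho i))"
  using k by (simp add: antiperiodic_def rho_period sg_add)

text \<open>An arbitrary choice \<open>f\<close> of a vertex from each run need not respect the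
  period, so only its values on the window from \<open>a\<close> are kept and continued.
  Monotonicity comes from that of \<open>rho\<close>.\<close>

lemma section_properties:
  assumes "\<And>r. rho (f r) = r"
  shows "rho (quasi_ext a k N f i) = i" "strict_mono (quasi_ext a k N f)"
proof -
  have *: "rho (quasi_ext a k N f i) = i" for i
    using rho_shift[of "f (a + (i - a) mod k)" "(i - a) div k"] assms
    by (simp add: quasi_ext_def mult.commute)
  then show "rho (quasi_ext a k N f i) = i" .
  show "strict_mono (quasi_ext a k N f)"
    by (rule strict_monoI) (rule rho_less, simp add: *)
qed

text \<open>On one vertex from each run the apex signs alternate, which gives access to the
  dichotomy for \<open>sg\<close>.\<close>

lemma section_bounded:
  assumes "window_bounded (\<lambda>i. sg (rho i)) z w N K" "\<And>r. rho (f r) = r"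
  shows "window_bounded sg (\<lambda>i. z (quasi_ext a k N f i)) w k K"
proof -
  have "window_bounded (\<lambda>i. sg (rho (quasi_ext a k N f i))) (\<lambda>i. z (quasi_ext a k N f i)) w k K"
    by (rule window_bounded_comp[OF assms(1) section_properties(2)[OF assms(2)]
          quasi_ext_add[OF k(2)]])
  then show ?thesis by (simp only: section_properties(1)[OF assms(2)])
qed

lemma section_antiperiodic:
  "antiperiodic N z \<Longrightarrow> antiperiodic k (\<lambda>i. z (quasi_ext a k N f i))"
  using k by (simp add: antiperiodic_def quasi_ext_add)

end

text \<open>These are the data of a new vertex: \<open>z\<close> gives its signs towards the line
  and \<open>w\<close> its sign towards the apex. The bound is what membership in the determinant
  class of \<open>k\<close> yields.\<close>

locale bounded_extension = run_numbering +
  fixes z :: "int \<Rightarrow> int" and w :: int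
  assumes z_antiperiodic: "antiperiodic N z"
    and z_sign: "z i \<in> {1, -1}" and w_sign: "w \<in> {1, -1}"
    and bounded: "window_bounded (\<lambda>i. sg (rho i)) z w N k"
begin

lemma z_add: "z (i + N) = - z i"
  using z_antiperiodic by (simp add: antiperiodic_def)

text \<open>In a list of \<open>k + 1\<close> vertices from \<open>e'\<close> to
  \<open>e + N\<close> the two end terms have the largest weights and add up to \<open>2 * k\<close>
  in absolute value. The bound \<open>k\<close> forces the signs in between and \<open>w\<close> to
  work against them.\<close>

lemma sign_change_in_run:
  assumes e: "e < e'" "rho e = r" "rho e' = r" and ze: "z e = - b" "z e' = b"
  shows "r < rho h \<Longrightarrow> rho h < r + k \<Longrightarrow> z h = b"
    and "w = - sg r * b"
proof -
  have b: "b \<in> {1, -1}" using z_sign[of e'] ze by simp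
  txt \<open>Taking one vertex from each run but both \<open>e\<close> and \<open>e'\<close>, with \<open>e\<close> moved to the end, makes
    the apex signs alternate along \<open>k + 1\<close> vertices.\<close>
  have doubled: "\<bar>w + (2 * k * (sg r * b)
      + (\<Sum>i = r+1..r+k-1. (2*r + k - 2*i) * (sg i * z (f i))))\<bar> \<le> k"
    if f: "\<And>i. rho (f i) = i" for f
  proof -
    define h where "h = f(r := e', r + k := e + N)"
    have rh: "rho (h i) = i" for i
      using e f by (simp add: h_def rho_period)
    have "\<bar>w + border_sum (\<lambda>i. sg (rho i)) z (map h [r..r+k])\<bar> \<le> k"
    proof (rule window_boundedD[OF bounded])
      show "sorted_wrt (<) (map h [r..r+k])"
        unfolding sorted_wrt_map
        by (rule sorted_wrt_mono_rel[OF _ sorted_wrt_upto]) (simp add: rh rho_less)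
      show "even (length (map h [r..r+k]))" using k by (simp add: even_nat_iff)
      fix a c assume "a \<in> set (map h [r..r+k])" "c \<in> set (map h [r..r+k])"
      then obtain i j where i: "r \<le> i" "a = h i" and j: "j \<le> r + k" "c = h j" by auto
      have "e < a"
      proof (cases "i = r")
        case True
        then show ?thesis using i e k by (simp add: h_def)
      next
        case False
        then show ?thesis using i rho_less[of e a] e rh by simp
      qed
      moreover have "c \<le> e + N"
      proof (cases "j = r + k")
        case False
        then show ?thesis using j rho_less[of c "e + N"] e rh rho_period[of e] by simp
      qed (use j in \<open>simp add: h_def\<close>)
      ultimately show "c < a + N" by simp
    qed
    moreover have "border_sum (\<lambda>i. sg (rho i)) z (map h [r..r+k])
      = (\<Sum>i = r..r+k. (2*r + k - 2*i) * (sg i * z (h i)))"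
    proof -
      have "r + (r + k) = 2 * r + k" by simp
      then show ?thesis
        using border_sum_upto[of "\<lambda>i. z (h i)" r "r + k"] by (simp only: border_sum_map rh)
    qed
    moreover have "{r..r+k} = insert r (insert (r+k) {r+1..r+k-1})" using k by auto
    moreover have "(\<Sum>i = r+1..r+k-1. (2*r + k - 2*i) * (sg i * z (h i)))
      = (\<Sum>i = r+1..r+k-1. (2*r + k - 2*i) * (sg i * z (f i)))"
      by (rule sum.cong) (auto simp: h_def)
    \<comment> \<open>The end terms have weights \<open>k\<close> and \<open>- k\<close> and values
      \<open>sg r * b\<close> and \<open>- sg r * b\<close>, whence
      \<open>2 * k * (sg r * b)\<close>.\<close>
    ultimately show ?thesis
      using k ze by (simp add: h_def z_add sg_add mult_ac)
  qed
  obtain f0 where f0: "\<And>i. rho (f0 i) = i" using rho_surj by metis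
  \<comment> \<open>The weights of the inner terms add up to 0, so an alternating middle contributes
    nothing and \<open>2 * k - 1 <= k\<close> remains.\<close>
  have alternating_mid: "k = 1"
    if f: "\<And>i. rho (f i) = i" and alt: "\<And>i. r < i \<Longrightarrow> i < r + k \<Longrightarrow> z (f i) = c * sg i" for f c
  proof -
    have "(\<Sum>i = r+1..r+k-1. (2*r + k - 2*i) * (sg i * z (f i)))
      = (\<Sum>i = r+1..r+k-1. c * (2*r + k - 2*i))"
      by (rule sum.cong) (auto simp: alt)
    also have "\<dots> = c * (\<Sum>i = r+1..r+int (nat (k-1)). 2*r + k - 2*i)"
      using k by (simp add: sum_distrib_left add_diff_eq)
    also have "\<dots> = 0" using k by (simp only: sum_weighted_constant) simp
    finally have "\<bar>w + 2 * k * (sg r * b)\<bar> \<le> k" using doubled[OF f] by simp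
    then show ?thesis using b w_sign sg_cases[of r] k by auto
  qed
  have constant_mid: "\<bar>w + 2 * k * (sg r * b) - (k - 1) * (sg r * d)\<bar> \<le> k"
    if f: "\<And>i. rho (f i) = i" and const: "\<And>i. r < i \<Longrightarrow> i < r + k \<Longrightarrow> z (f i) = d" for f d
  proof -
    have "(\<Sum>i = r+1..r+k-1. (2*r + k - 2*i) * (sg i * z (f i)))
      = (\<Sum>i = r+1..r+k-1. d * ((2*r + k - 2*i) * sg i))"
      by (rule sum.cong) (auto simp: const)
    also have "\<dots> = d * (\<Sum>i = r+1..r+int (nat (k-1)). (2*r + k - 2*i) * sg i)"
      using k by (simp add: sum_distrib_left add_diff_eq)
    also have "\<dots> = - (k - 1) * (sg r * d)"
      using k by (simp only: sum_weighted_alternating) (simp add: even_nat_iff)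
    finally show ?thesis using doubled[OF f] by (simp add: algebra_simps)
  qed
  have monotone: "\<exists>j\<ge>r. \<forall>i. r < i \<and> i < r + k \<longrightarrow> z (f i) = (if i \<le> j then b' else - b')"
    if f: "\<And>i. rho (f i) = i" and fr: "z (f r) = b'" and k1: "k \<noteq> 1" for f b'
  proof -
    define g where "g = quasi_ext r k N f"
    have gw: "g i = f i" if "r \<le> i" "i < r + k" for i
      using that by (simp add: g_def quasi_ext_window)
    have gk: "z (g (i + k)) = - z (g i)" for i
      using k by (simp add: g_def quasi_ext_add z_add)
    show ?thesis
    proof (rule sign_sequence_dichotomy[of k "\<lambda>i. z (g i)" w, where r = r])
      show "odd k" "0 < k" by (fact k)+
      show "antiperiodic k (\<lambda>i. z (g i))"
        unfolding g_def by (rule section_antiperiodic[OF z_antiperiodic])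
      show "window_bounded sg (\<lambda>i. z (g i)) w k k"
        unfolding g_def by (rule section_bounded[OF bounded f])
    next
      fix c assume "\<And>i. z (g i) = c * sg i"
      moreover have "z (f i) = c * sg i" if "r < i" "i < r + k" for i
        using calculation[of i] gw[of i] that by simp
      ultimately have "k = 1" by (intro alternating_mid[OF f, of c])
      then show ?thesis using k1 by simp
    next
      fix j c assume j: "r \<le> j" "j < r + k"
        and const: "\<And>i. j + 1 \<le> i \<Longrightarrow> i \<le> j + k \<Longrightarrow> z (g i) = c"
      have "c = - b'" using const[of "r + k"] j gk[of r] gw[of r] fr k by simp
      moreover have "z (f i) = c" if "r < i" "i < r + k" "j < i" for i
        using const[of i] gw[of i] that j by simp
      moreover have "z (f i) = - c" if "r < i" "i < r + k" "i \<le> j" for i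
        using const[of "i + k"] gk[of i] gw[of i] that j by simp
      ultimately show ?thesis using j(1) by (intro exI[of _ j]) auto
    qed (rule z_sign)
  qed
  \<comment> \<open>Run \<open>r\<close> may be represented by \<open>e'\<close> or by
    \<open>e\<close>. The first choice lets the middle change at most once from \<open>b\<close> to
    \<open>- b\<close>, the second at most once from \<open>- b\<close> to \<open>b\<close>, so it
    is constant. The constant \<open>- b\<close> would give a sum of absolute value at least
    \<open>3 * k - 2\<close>.\<close>
  have mid: "z (f i) = b" if f: "\<And>i. rho (f i) = i" and i: "r < i" "i < r + k" for f i
  proof -
    have k3: "k \<ge> 3" using i k by presburger
    have f1: "rho ((f(r := e')) i) = i" and f2: "rho ((f(r := e)) i) = i" for i
      using f[of i] e by simp_all
    have "k \<noteq> 1" using k3 by simp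
    then obtain j j' where J: "j \<ge> r" "j' \<ge> r"
      "\<forall>i. r < i \<and> i < r + k \<longrightarrow> z ((f(r := e')) i) = (if i \<le> j then b else - b)"
      "\<forall>i. r < i \<and> i < r + k \<longrightarrow> z ((f(r := e)) i) = (if i \<le> j' then - b else - (- b))"
      using monotone[OF f1, of b] monotone[OF f2, of "- b"] ze unfolding fun_upd_same by blast
    have j: "z (f i) = (if i \<le> j then b else - b)"
      and j': "z (f i) = (if i \<le> j' then - b else b)" if "r < i" "i < r + k" for i
      using J(3,4)[rule_format, of i] that by simp_all
    show ?thesis
    proof (cases "z (f (r + 1)) = b")
      case True
      then have "j' < r + 1" using j'[of "r+1"] k3 b by (auto split: if_splits)
      then show ?thesis using j'[OF i] i by simp
    next
      case False
      then have "j < r + 1" using j[of "r+1"] k3 by (auto split: if_splits)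
      then have "z (f i) = - b" if "r < i" "i < r + k" for i
        using j[OF that] that by simp
      then have "\<bar>w + 2 * k * (sg r * b) - (k - 1) * (sg r * - b)\<bar> \<le> k"
        by (rule constant_mid[OF f])
      then show ?thesis using b w_sign sg_cases[of r] k3 by auto
    qed
  qed
  show "z h = b" if "r < rho h" "rho h < r + k"
    using mid[of "f0(rho h := h)" "rho h"] f0 that by simp
  have "\<bar>w + 2 * k * (sg r * b) - (k - 1) * (sg r * b)\<bar> \<le> k"
    by (rule constant_mid[OF f0]) (rule mid[OF f0])
  then show "w = - sg r * b" using b w_sign sg_cases[of r] k by auto
qed

text \<open>Either \<open>z\<close> changes inside a run, and \<open>sign_change_in_run\<close>
  fixes everything, or \<open>z\<close> factors through \<open>rho\<close> and the dichotomy
  applies. In the case \<open>vertex\<close> the new vertex has, up to the factor \<open>c\<close>,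
  the signs of line vertex \<open>j\<close>, whose own sequence is constant over the period
  following it.\<close>

theorem extension_cases:
  obtains (apex) c where "c \<in> {1, -1}" "\<And>i. z i = c * sg (rho i)"
  | (vertex) j c where "c \<in> {1, -1}" "\<And>i. j < i \<Longrightarrow> i < j + N \<Longrightarrow> z i = c" "w = - c * sg (rho j)"
proof (cases "\<exists>e. rho (e+1) = rho e \<and> z (e+1) \<noteq> z e")
  case True
  then obtain e where e: "rho (e+1) = rho e" "z (e+1) \<noteq> z e" by blast
  define b where "b = z (e+1)"
  have b: "b \<in> {1, -1}" using z_sign by (simp add: b_def)
  have ze: "z e = - b" using e(2) z_sign[of e] b by (auto simp: b_def)
  note in_run = sign_change_in_run[of _ _ "rho e"]
  have w: "w = - sg (rho e) * b"
    by (rule in_run(2)[of e "e+1"]) (use e ze in \<open>simp_all add: b_def\<close>)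
  show thesis
  proof (rule vertex[of b e])
    fix i assume i: "e < i" "i < e + N"
    have rho_i: "rho e \<le> rho i" "rho i \<le> rho e + k"
      using rho_le[of e i] rho_le[of i "e + N"] i by (simp_all add: rho_period)
    show "z i = b"
    proof (rule ccontr)
      assume "z i \<noteq> b"
      then have zi: "z i = - b" using z_sign[of i] b by auto
      \<comment> \<open>In the run of \<open>e\<close> or its translate, a wrong sign at
        \<open>i\<close> would be a sign change in the opposite direction, which gives the opposite
        value of \<open>w\<close>.\<close>
      consider "rho i = rho e" | "rho i = rho e + k" | "rho e < rho i" "rho i < rho e + k"
        using rho_i by linarith
      then have "w = sg (rho e) * b \<or> z i = b"
      proof cases
        case 1
        then have "i \<noteq> e + 1" using zi b by (auto simp: b_def)
        then have "w = - sg (rho e) * - b"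
          using i e 1 zi by (intro in_run(2)[of "e+1" i]) (auto simp: b_def)
        then show ?thesis by simp
      next
        case 2
        have "z (i - N) = b" "rho (i - N) = rho e"
          using zi z_add[of "i - N"] rho_period[of "i - N"] 2 by simp_all
        then have "w = - sg (rho e) * - b"
          using i ze by (intro in_run(2)[of "i - N" e]) auto
        then show ?thesis by simp
      next
        case 3
        then have "z i = b"
          by (intro in_run(1)[of e "e+1" b i]) (use e ze in \<open>simp_all add: b_def\<close>)
        then show ?thesis ..
      qed
      then show False using w zi b sg_cases[of "rho e"] by auto
    qed
  qed (use b w in auto)
next
  case False
  have run_const_le: "z i = z j" if "rho i = rho j" "i \<le> j" for i j
    using that(2,1)
  proof (induction j rule: int_ge_induct)
    case (step j)
    have "rho i \<le> rho j" "rho j \<le> rho (j+1)" using step.hyps by (auto intro: rho_le)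
    then have "rho (j+1) = rho j" "rho i = rho j" using step.prems by auto
    then show ?case using step.IH False by auto
  qed simp
  have run_const: "z i = z j" if "rho i = rho j" for i j
    using run_const_le that by (metis linear)
  obtain f where f: "\<And>i. rho (f i) = i" using rho_surj by metis
  define g where "g = quasi_ext 0 k N f"
  have g: "rho (g i) = i" for i unfolding g_def by (rule section_properties(1)[OF f])
  have zg: "z i = z (g (rho i))" for i by (rule run_const) (simp add: g)
  show thesis
  proof (rule sign_sequence_dichotomy[of k "\<lambda>i. z (g i)" w, where r = 0])
    show "odd k" "0 < k" by (fact k)+
    show "antiperiodic k (\<lambda>i. z (g i))"
      unfolding g_def by (rule section_antiperiodic[OF z_antiperiodic])
    show "window_bounded sg (\<lambda>i. z (g i)) w k k"
      unfolding g_def by (rule section_bounded[OF bounded f])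
  next
    fix c assume "c \<in> {1, -1}" and c: "\<And>i. z (g i) = c * sg i"
    moreover have "z i = c * sg (rho i)" for i using zg[of i] c[of "rho i"] by simp
    ultimately show thesis by (intro apex[of c])
  next
    fix j c assume c: "c \<in> {1, -1}"
      and const: "\<And>i. j + 1 \<le> i \<Longrightarrow> i \<le> j + k \<Longrightarrow> z (g i) = c"
    obtain a where a: "rho a = j" using rho_surj by blast
    obtain d where d: "rho d = j + 1" using rho_surj by blast
    have "a \<le> d" using rho_less[of a d] a d by simp
    then have "\<exists>e\<ge>a. rho e = j \<and> rho (e + 1) = j + 1"
      using d
    proof (induction d rule: int_ge_induct)
      case base
      then show ?case using a by simp
    next
      case (step d)
      then show ?case using rho_step[of d] by auto
    qed
    then obtain e where e: "rho e = j" "rho (e + 1) = j + 1" by blast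
    have ze: "z i = c" if "e < i" "i \<le> e + N" for i
    proof -
      have "j + 1 \<le> rho i" "rho i \<le> j + k"
        using rho_le[of "e+1" i] rho_le[of i "e+N"] that e by (simp_all add: rho_period)
      then show ?thesis using const[of "rho i"] zg[of i] by simp
    qed
    \<comment> \<open>Both \<open>e\<close>, the last vertex of run \<open>j\<close>, and
      \<open>e + 1\<close>, the first of the next run, fit \<open>z\<close>. Their apex signs are
      opposite, so exactly one of them fits \<open>w\<close>.\<close>
    show thesis
    proof (cases "w = - c * sg j")
      case True
      then show thesis using vertex[of c e] c ze e by simp
    next
      case False
      then have "w = - c * sg (j + 1)"
        using w_sign c sg_cases[of j] by (auto simp: sg_add)
      moreover have "z i = c" if "e + 1 < i" "i < e + 1 + N" for i
        using ze that by simp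
      ultimately show thesis using vertex[of c "e+1"] c e by simp
    qed
  qed (rule z_sign)
qed

end

section \<open>Determinants of skew matrices with a transitive part\<close>

definition det_on :: "('a \<Rightarrow> 'a \<Rightarrow> int) \<Rightarrow> 'a list \<Rightarrow> int" where
  "det_on A vs = det (mat (length vs) (length vs) (\<lambda>(i, j). A (vs ! i) (vs ! j)))"

lemma det_on_perm:
  assumes "mset vs = mset vs'"
  shows "det_on A vs = det_on A vs'"
proof -
  obtain p where p: "p permutes {..<length vs'}" "permute_list p vs' = vs"
    using mset_eq_permutation[OF assms] by blast
  define n where "n = length vs'"
  have pn: "p permutes {0..<n}" using p(1) by (simp add: n_def lessThan_atLeast0)
  define M where "M = mat n n (\<lambda>(i, j). A (vs' ! i) (vs' ! j))"
  define M1 where "M1 = mat n n (\<lambda>(i, j). M $$ (p i, j))"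
  define M2 where "M2 = mat n n (\<lambda>(i, j). M1\<^sup>T $$ (p i, j))"
  have pi: "p i < n" if "i < n" for i
    using permutes_in_image[OF pn, of i] that by simp
  have len: "length vs = n" using assms by (metis n_def size_mset)
  have "vs ! i = vs' ! p i" if "i < n" for i
    using that p by (metis lessThan_iff n_def permute_list_nth)
  then have "mat (length vs) (length vs) (\<lambda>(i, j). A (vs ! i) (vs ! j)) = M2\<^sup>T"
    by (intro eq_matI) (auto simp: M2_def M1_def M_def len pi)
  then have "det_on A vs = det M2"
    using det_transpose[of M2 n] by (simp add: det_on_def M2_def)
  also have "\<dots> = signof p * det (M1\<^sup>T)"
    unfolding M2_def by (rule det_permute_rows[OF _ pn]) (simp add: M1_def)
  also have "det (M1\<^sup>T) = det M1"
    by (rule det_transpose[of _ n]) (simp add: M1_def)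
  also have "det M1 = signof p * det M"
    unfolding M1_def by (rule det_permute_rows[OF _ pn]) (simp add: M_def)
  also have "signof p * (signof p * det M) = det M"
    by (simp add: sign_def)
  finally show ?thesis by (simp add: det_on_def M_def n_def)
qed

lemma det_on_cong:
  assumes "\<And>u v. u \<in> set vs \<Longrightarrow> v \<in> set vs \<Longrightarrow> A u v = B u v"
  shows "det_on A vs = det_on B vs"
  unfolding det_on_def by (rule arg_cong[of _ _ det], rule eq_matI) (auto intro: assms)

definition skew :: "('a \<Rightarrow> 'a \<Rightarrow> int) \<Rightarrow> bool" where
  "skew A \<longleftrightarrow> (\<forall>u v. A u v = - A v u)"

lemma skewD: "skew A \<Longrightarrow> A u v = - A v u"
  unfolding skew_def by blast

lemma skew_self: "skew A \<Longrightarrow> A u u = 0"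
  using skewD[of A u u] by simp

lemma det_on_skew_odd:
  assumes "skew A" "odd (length vs)"
  shows "det_on A vs = 0"
proof -
  define n where "n = length vs"
  define M where "M = mat n n (\<lambda>(i, j). A (vs ! i) (vs ! j))"
  have "M\<^sup>T = (-1) \<cdot>\<^sub>m M"
  proof (rule eq_matI)
    fix i j assume "i < dim_row ((-1) \<cdot>\<^sub>m M)" "j < dim_col ((-1) \<cdot>\<^sub>m M)"
    then show "M\<^sup>T $$ (i, j) = ((-1) \<cdot>\<^sub>m M) $$ (i, j)"
      using skewD[OF assms(1), of "vs ! j" "vs ! i"] by (simp add: M_def)
  qed (simp_all add: M_def)
  moreover have "det (M\<^sup>T) = det M" by (rule det_transpose[of _ n]) (simp add: M_def)
  ultimately have "det M = (-1) ^ n * det M" by (simp add: M_def)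
  then show ?thesis using assms(2) by (simp add: det_on_def M_def n_def)
qed

lemma det_two:
  assumes "A \<in> carrier_mat 2 2"
  shows "det A = A $$ (0, 0) * A $$ (1, 1) - A $$ (0, 1) * A $$ (1, 0)"
proof -
  have "det (mat_delete A 0 j) = mat_delete A 0 j $$ (0, 0)" for j
    by (rule det_single) (use assms in \<open>auto intro!: mat_delete_carrier\<close>)
  then show ?thesis
    using laplace_expansion_row[OF assms, of 0] assms
    by (simp add: numeral_2_eq_2 cofactor_def mat_delete_def)
qed

text \<open>The Schur complement of the principal block on \<open>{a, b}\<close>.\<close>

definition pivot :: "'a \<Rightarrow> 'a \<Rightarrow> ('a \<Rightarrow> 'a \<Rightarrow> int) \<Rightarrow> 'a \<Rightarrow> 'a \<Rightarrow> int" where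
  "pivot a b A u v = A u v + A u a * A b v - A u b * A a v"

lemma skew_pivot: "skew A \<Longrightarrow> skew (pivot a b A)"
  unfolding skew_def pivot_def
  by (metis (no_types, opaque_lifting) diff_add_eq_diff_diff_swap minus_diff_eq
      minus_mult_commute mult.commute uminus_add_conv_diff add.commute)

lemma det_on_pivot:
  assumes "skew A" "A a b = 1"
  shows "det_on A (a # b # vs) = det_on (pivot a b A) vs"
proof -
  define n where "n = length vs"
  define J where "J = mat 2 2 (\<lambda>(i, j). A ([a, b] ! i) ([a, b] ! j))"
  define B where "B = mat 2 n (\<lambda>(i, j). A ([a, b] ! i) (vs ! j))"
  define C where "C = mat n 2 (\<lambda>(i, j). A (vs ! i) ([a, b] ! j))"
  define D where "D = mat n n (\<lambda>(i, j). A (vs ! i) (vs ! j))"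
  \<comment> \<open>This is \<open>- C\<close> times the inverse of \<open>J\<close>, so
    multiplication by \<open>L\<close> clears the lower left block.\<close>
  define X where "X = mat n 2 (\<lambda>(i, j). if j = 0 then - A (vs ! i) b else A (vs ! i) a)"
  define L where "L = four_block_mat (1\<^sub>m 2) (0\<^sub>m 2 n) X (1\<^sub>m n)"
  have carr: "J \<in> carrier_mat 2 2" "B \<in> carrier_mat 2 n" "C \<in> carrier_mat n 2"
    "D \<in> carrier_mat n n" "X \<in> carrier_mat n 2"
    by (simp_all add: J_def B_def C_def D_def X_def)
  have ent: "A a a = 0" "A b b = 0" "A b a = -1"
    using skew_self[OF assms(1)] skewD[OF assms(1), of b a] assms(2) by simp_all
  have M: "mat (length (a # b # vs)) (length (a # b # vs))
      (\<lambda>(i, j). A ((a # b # vs) ! i) ((a # b # vs) ! j)) = four_block_mat J B C D"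
  proof (rule eq_matI)
    fix i j assume "i < dim_row (four_block_mat J B C D)" "j < dim_col (four_block_mat J B C D)"
    then have ij: "i < n + 2" "j < n + 2" by (simp_all add: J_def D_def)
    have nth: "(a # b # vs) ! l = (if l < 2 then [a, b] ! l else vs ! (l - 2))" for l
      by (auto simp: nth_Cons split: nat.splits)
    show "mat (length (a # b # vs)) (length (a # b # vs))
        (\<lambda>(i, j). A ((a # b # vs) ! i) ((a # b # vs) ! j)) $$ (i, j) = four_block_mat J B C D $$ (i, j)"
      unfolding nth using ij by (simp add: J_def B_def C_def D_def n_def)
  qed (simp_all add: J_def D_def n_def)
  have XJ: "X * J + C = 0\<^sub>m n 2"
    by (rule eq_matI)
      (auto simp: X_def J_def C_def scalar_prod_def numeral_2_eq_2 less_Suc_eq ent assms(2))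
  have XB: "X * B + D = mat n n (\<lambda>(i, j). pivot a b A (vs ! i) (vs ! j))"
    by (rule eq_matI)
      (auto simp: X_def B_def D_def scalar_prod_def numeral_2_eq_2 pivot_def)
  have "L * four_block_mat J B C D
    = four_block_mat (1\<^sub>m 2 * J + 0\<^sub>m 2 n * C) (1\<^sub>m 2 * B + 0\<^sub>m 2 n * D)
        (X * J + 1\<^sub>m n * C) (X * B + 1\<^sub>m n * D)"
    unfolding L_def by (rule mult_four_block_mat) (use carr in auto)
  also have "\<dots> = four_block_mat J B (0\<^sub>m n 2) (X * B + D)"
    using carr XJ by simp
  finally have LM: "L * four_block_mat J B C D = four_block_mat J B (0\<^sub>m n 2) (X * B + D)" .
  have "det L = 1"
    unfolding L_def using carr
    by (subst det_four_block_mat_upper_right_zero[of _ 2 _ n]) auto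
  moreover have "det (L * four_block_mat J B C D) = det L * det (four_block_mat J B C D)"
    by (rule det_mult[of _ "2 + n"]) (use carr in \<open>auto simp: L_def\<close>)
  ultimately have "det (four_block_mat J B C D) = det (four_block_mat J B (0\<^sub>m n 2) (X * B + D))"
    using LM by simp
  also have "\<dots> = det J * det (X * B + D)"
    by (rule det_four_block_mat_lower_left_zero) (use carr in auto)
  also have "det J = 1"
    by (subst det_two) (auto simp: J_def ent assms(2))
  finally show ?thesis
    unfolding det_on_def M XB by (simp add: n_def)
qed

lemma det_on_pair:
  assumes "skew A"
  shows "det_on A [u, v] = (A u v)\<^sup>2"
  unfolding det_on_def using skew_self[OF assms] skewD[OF assms, of v u]
  by (subst det_two) (auto simp: power2_eq_square)

section \<open>Determinants of transitive lists with up to two apexes\<close>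

abbreviation transitive_list :: "('a \<Rightarrow> 'a \<Rightarrow> int) \<Rightarrow> 'a list \<Rightarrow> bool" where
  "transitive_list A \<equiv> sorted_wrt (\<lambda>a b. A a b = 1)"

lemma alt_sum_const_even: "even (length L) \<Longrightarrow> alt_sum (\<lambda>_. c) L = 0"
  and alt_sum_const_odd: "odd (length L) \<Longrightarrow> alt_sum (\<lambda>_. c) L = c"
  by (induction L) auto

lemma alt_sum_add: "alt_sum (\<lambda>v. f v + g v) L = alt_sum f L + alt_sum g L"
  by (induction L) auto

lemma border_sum_translate:
  assumes "even (length L)"
  shows "border_sum (\<lambda>v. x v + c) (\<lambda>v. z v + d) L
    = border_sum x z L + d * alt_sum x L - c * alt_sum z L"
  using assms
proof (induction L rule: induct_list012)
  case (3 u v L)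
  then show ?case
    by (simp add: algebra_simps alt_sum_add alt_sum_const_even)
qed simp_all

lemma border_sum_ones: "even (length L) \<Longrightarrow> border_sum x (\<lambda>_. 1) L = alt_sum x L"
  by (induction L rule: induct_list012) (simp_all add: alt_sum_const_even)

text \<open>Eliminating the first two vertices of a transitive list leaves the arcs between the
  remaining ones unchanged and translates the two border rows by constants.\<close>

lemma det_on_bordered_transitive:
  assumes "skew A" "even (length L)" "transitive_list A L"
  shows "det_on A (L @ [u, v]) = (A u v + border_sum (A v) (A u) L)\<^sup>2"
  using assms
proof (induction L arbitrary: A rule: induct_list012)
  case 1
  then show ?case by (simp add: det_on_pair)
next
  case (3 a b L)
  define A' where "A' = pivot a b A"
  have "A a b = 1" using 3 by simp
  then have "det_on A ((a # b # L) @ [u, v]) = det_on A' (L @ [u, v])"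
    using 3 by (simp add: A'_def det_on_pivot)
  also have "\<dots> = (A' u v + border_sum (A' v) (A' u) L)\<^sup>2"
  proof (rule "3.IH"(1))
    show "skew A'" using 3 by (simp add: A'_def skew_pivot)
    have "A' c d = A c d" if "c \<in> set L" "d \<in> set L" for c d
      using "3.prems" that skewD[OF \<open>skew A\<close>, of c a] skewD[OF \<open>skew A\<close>, of c b]
      by (simp add: A'_def pivot_def)
    then show "transitive_list A' L"
      using "3.prems"(3) sorted_wrt_mono_rel[of L "\<lambda>a b. A a b = 1" "\<lambda>a b. A' a b = 1"] by simp
  qed (use 3 in simp)
  also have "border_sum (A' v) (A' u) L
      = border_sum (\<lambda>t. A v t + (A v a - A v b)) (\<lambda>t. A u t + (A u a - A u b)) L"
    by (rule border_sum_cong) (use "3.prems" in \<open>simp_all add: A'_def pivot_def\<close>)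
  also have "\<dots> = border_sum (A v) (A u) L + (A u a - A u b) * alt_sum (A v) L
      - (A v a - A v b) * alt_sum (A u) L"
    by (rule border_sum_translate) (use 3 in simp)
  also have "A' u v + \<dots> = A u v + border_sum (A v) (A u) (a # b # L)"
    using skewD[OF \<open>skew A\<close>, of a v] skewD[OF \<open>skew A\<close>, of b v]
    by (simp add: A'_def pivot_def algebra_simps)
  finally show ?case by simp
qed simp

text \<open>The first vertex of \<open>L\<close> dominates the others and can serve as a second
  border row with constant entries; an even transitive list remains.\<close>

lemma det_on_transitive_apex:
  assumes "skew A" "odd (length L)" "transitive_list A L"
  shows "det_on A (L @ [v]) = (alt_sum (A v) L)\<^sup>2"
proof (cases L)
  case (Cons t M)
  have "det_on A (L @ [v]) = det_on A (M @ [t, v])"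
    by (rule det_on_perm) (simp add: Cons)
  also have "\<dots> = (A t v + border_sum (A v) (A t) M)\<^sup>2"
    by (rule det_on_bordered_transitive) (use assms Cons in auto)
  also have "border_sum (A v) (A t) M = border_sum (A v) (\<lambda>_. 1) M"
    by (rule border_sum_cong) (use assms Cons in auto)
  also have "\<dots> = alt_sum (A v) M"
    by (rule border_sum_ones) (use assms Cons in auto)
  finally show ?thesis
    using skewD[OF assms(1), of t v] by (simp add: Cons power2_commute)
qed (use assms in simp)

text \<open>Here the first vertex serves as an apex with constant signs over an odd list.\<close>

lemma det_on_transitive:
  assumes "skew A" "even (length L)" "transitive_list A L"
  shows "det_on A L = 1"
proof (cases "L = []")
  case False
  then obtain t M where L: "L = t # M" by (cases L) auto
  have "det_on A L = det_on A (M @ [t])"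
    by (rule det_on_perm) (simp add: L)
  also have "\<dots> = (alt_sum (A t) M)\<^sup>2"
    by (rule det_on_transitive_apex) (use assms L in auto)
  also have "alt_sum (A t) M = alt_sum (\<lambda>_. 1) M"
    by (rule alt_sum_cong) (use assms L in auto)
  also have "\<dots> = 1"
    by (rule alt_sum_const_odd) (use assms L in auto)
  finally show ?thesis by simp
qed (simp add: det_on_def)

text \<open>Since \<open>p\<close> and \<open>q\<close> have equal signs towards the line, pivoting
  on them leaves the line unchanged and only adds a multiple of \<open>x\<close> to the row of
  \<open>u\<close>. That multiple is 0 or \<plusminus>2 when \<open>u\<close> has signs
  \<plusminus>1 towards both.\<close>

lemma det_on_transitive_twin_apexes:
  assumes "skew A" "odd (length L)" "transitive_list A L"
    and "A p q = 1" "\<And>t. t \<in> set L \<Longrightarrow> A p t = x t" "\<And>t. t \<in> set L \<Longrightarrow> A q t = x t"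
  shows "det_on A (p # q # L @ [u]) = (alt_sum (\<lambda>t. A u t + (A u p - A u q) * x t) L)\<^sup>2"
proof -
  define A' where "A' = pivot p q A"
  have "det_on A (p # q # L @ [u]) = det_on A' (L @ [u])"
    using assms by (simp add: A'_def det_on_pivot)
  also have "\<dots> = (alt_sum (A' u) L)\<^sup>2"
  proof (rule det_on_transitive_apex)
    have "A' c d = A c d" if "c \<in> set L" "d \<in> set L" for c d
      using assms that skewD[OF \<open>skew A\<close>, of c p] skewD[OF \<open>skew A\<close>, of c q]
      by (simp add: A'_def pivot_def)
    then show "transitive_list A' L"
      using assms(3) sorted_wrt_mono_rel[of L "\<lambda>a b. A a b = 1" "\<lambda>a b. A' a b = 1"] by simp
  qed (use assms in \<open>simp_all add: A'_def skew_pivot\<close>)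
  also have "alt_sum (A' u) L = alt_sum (\<lambda>t. A u t + (A u p - A u q) * x t) L"
    by (rule alt_sum_cong) (use assms in \<open>simp add: A'_def pivot_def algebra_simps\<close>)
  finally show ?thesis .
qed

section \<open>Tournaments formed by a line and its apexes\<close>

text \<open>Unlike \<open>theta\<close>, it vanishes on pairs without an arc. For a tournament it is
  therefore skew on the whole type, as the determinant lemmas require.\<close>

definition arc_sign :: "'a pair_pre_digraph \<Rightarrow> 'a \<Rightarrow> 'a \<Rightarrow> int" where
  "arc_sign T u v = (if (u, v) \<in> parcs T then 1 else if (v, u) \<in> parcs T then -1 else 0)"

lemma tournament_iff:
  "tournament T \<longleftrightarrow> finite (pverts T) \<and> pverts T \<noteq> {} \<and> parcs T \<subseteq> pverts T \<times> pverts T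
     \<and> (\<forall>u. (u, u) \<notin> parcs T)
     \<and> (\<forall>u \<in> pverts T. \<forall>v \<in> pverts T. u \<noteq> v \<longrightarrow> ((u, v) \<in> parcs T \<longleftrightarrow> (v, u) \<notin> parcs T))"
proof -
  have "pair_digraph T \<longleftrightarrow> finite (pverts T) \<and> parcs T \<subseteq> pverts T \<times> pverts T
      \<and> (\<forall>u. (u, u) \<notin> parcs T)"
  proof
    assume "pair_digraph T"
    then interpret pair_digraph T .
    show "finite (pverts T) \<and> parcs T \<subseteq> pverts T \<times> pverts T \<and> (\<forall>u. (u, u) \<notin> parcs T)"
      using pair_finite_verts pair_no_loops arc_fst_in_verts arc_snd_in_verts by force
  next
    assume *: "finite (pverts T) \<and> parcs T \<subseteq> pverts T \<times> pverts T \<and> (\<forall>u. (u, u) \<notin> parcs T)"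
    then have "finite (parcs T)" by (meson finite_SigmaI finite_subset)
    with * show "pair_digraph T" by unfold_locales auto
  qed
  then show ?thesis unfolding tournament_def by blast
qed

lemma tournamentD:
  assumes "tournament T"
  shows "finite (pverts T)" "pverts T \<noteq> {}" "parcs T \<subseteq> pverts T \<times> pverts T" "(u, u) \<notin> parcs T"
    "u \<in> pverts T \<Longrightarrow> v \<in> pverts T \<Longrightarrow> u \<noteq> v \<Longrightarrow> (u, v) \<in> parcs T \<longleftrightarrow> (v, u) \<notin> parcs T"
proof -
  note * = assms[unfolded tournament_iff]
  show "finite (pverts T)" "pverts T \<noteq> {}" "parcs T \<subseteq> pverts T \<times> pverts T" "(u, u) \<notin> parcs T"
    using *[THEN conjunct1] *[THEN conjunct2, THEN conjunct1]
      *[THEN conjunct2, THEN conjunct2, THEN conjunct1]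
      *[THEN conjunct2, THEN conjunct2, THEN conjunct2, THEN conjunct1] by auto
  show "(u, v) \<in> parcs T \<longleftrightarrow> (v, u) \<notin> parcs T"
    if "u \<in> pverts T" "v \<in> pverts T" "u \<noteq> v"
    by (rule *[THEN conjunct2, THEN conjunct2, THEN conjunct2, THEN conjunct2,
          THEN bspec, THEN bspec, THEN mp]) (fact that)+
qed

lemma tournament_asym:
  assumes "tournament T" "(u, v) \<in> parcs T"
  shows "(v, u) \<notin> parcs T"
proof -
  have "u \<in> pverts T" "v \<in> pverts T"
    using subsetD[OF tournamentD(3)[OF assms(1)] assms(2)] by auto
  moreover have "u \<noteq> v" using tournamentD(4)[OF assms(1)] assms(2) by metis
  ultimately show ?thesis using tournamentD(5)[OF assms(1), of u v] assms(2) by simp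
qed

lemma skew_arc_sign:
  assumes "tournament T"
  shows "skew (arc_sign T)"
  unfolding skew_def arc_sign_def using tournament_asym[OF assms] by simp

lemma arc_sign_eq_theta:
  assumes "tournament T" "u \<in> pverts T" "v \<in> pverts T" "u \<noteq> v"
  shows "arc_sign T u v = theta T u v"
  using tournamentD(5)[OF assms] by (simp add: arc_sign_def theta_def)

lemma arc_sign_values:
  assumes "tournament T" "u \<in> pverts T" "v \<in> pverts T" "u \<noteq> v"
  shows "arc_sign T u v \<in> {1, -1}"
  using arc_sign_eq_theta[OF assms] by (simp add: theta_def)

lemma tournament_det_eq:
  assumes "distinct vs" "set vs = pverts T"
  shows "tournament_det T = det_on (arc_sign T) vs"
proof -
  define ws where "ws = (SOME vs. distinct vs \<and> set vs = pverts T)"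
  have "distinct ws \<and> set ws = pverts T"
    unfolding ws_def by (rule someI) (use assms in blast)
  then have "mset ws = mset vs"
    using assms set_eq_iff_mset_eq_distinct by metis
  then have "det_on (arc_sign T) ws = det_on (arc_sign T) vs" by (rule det_on_perm)
  then show ?thesis
    by (simp add: tournament_det_def skew_adjacency_mat_def det_on_def arc_sign_def ws_def)
qed

text \<open>Induced subtournaments correspond to nonempty vertex sets, and the determinant may be
  computed along any listing of such a set.\<close>

lemma det_class_iff:
  "T \<in> det_class K \<longleftrightarrow> tournament T \<and> 1 \<le> K \<and>
     (\<forall>vs. distinct vs \<and> vs \<noteq> [] \<and> set vs \<subseteq> pverts T \<longrightarrow> det_on (arc_sign T) vs \<le> K\<^sup>2)"
    (is "_ \<longleftrightarrow> _ \<and> _ \<and> ?bounded")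
proof -
  have "(\<forall>H. tournament H \<and> induced_subgraph (with_proj H) (with_proj T) \<longrightarrow> tournament_det H \<le> K\<^sup>2)
      \<longleftrightarrow> ?bounded" if T: "tournament T"
  proof (intro iffI allI impI; elim conjE)
    fix vs assume
      bnd: "\<forall>H. tournament H \<and> induced_subgraph (with_proj H) (with_proj T) \<longrightarrow> tournament_det H \<le> K\<^sup>2"
      and vs: "distinct vs" "vs \<noteq> []" "set vs \<subseteq> pverts T"
    define H where "H = \<lparr> pverts = set vs, parcs = parcs T \<inter> set vs \<times> set vs \<rparr>"
    have H: "tournament H"
      unfolding tournament_iff
    proof (intro conjI ballI allI impI)
      show "(u, v) \<in> parcs H \<longleftrightarrow> (v, u) \<notin> parcs H"
        if "u \<in> pverts H" "v \<in> pverts H" "u \<noteq> v" for u v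
        using tournamentD(5)[OF T, of u v] that vs(3) by (auto simp: H_def)
    qed (use vs tournamentD(4)[OF T] in \<open>auto simp: H_def\<close>)
    moreover have "induced_subgraph (with_proj H) (with_proj T)"
      using tournamentD(3)[OF T] vs(3)
      by (auto simp: induced_subgraph_def subgraph_def compatible_def wf_digraph_def H_def)
    ultimately have "tournament_det H \<le> K\<^sup>2" using bnd by blast
    moreover have "tournament_det H = det_on (arc_sign H) vs"
      by (rule tournament_det_eq) (use vs in \<open>simp_all add: H_def\<close>)
    moreover have "det_on (arc_sign H) vs = det_on (arc_sign T) vs"
      by (rule det_on_cong) (simp add: H_def arc_sign_def)
    ultimately show "det_on (arc_sign T) vs \<le> K\<^sup>2" by simp
  next
    fix H assume bnd: ?bounded
      and H: "tournament H" "induced_subgraph (with_proj H) (with_proj T)"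
    obtain vs where vs: "set vs = pverts H" "distinct vs"
      using finite_distinct_list[OF tournamentD(1)[OF H(1)]] by blast
    have "vs \<noteq> []" "set vs \<subseteq> pverts T"
      using H(2) tournamentD(2)[OF H(1)] vs by (auto simp: induced_subgraph_def subgraph_def)
    then have "det_on (arc_sign T) vs \<le> K\<^sup>2" using bnd vs by blast
    moreover have "tournament_det H = det_on (arc_sign H) vs"
      by (rule tournament_det_eq) (use vs in simp_all)
    moreover have "det_on (arc_sign H) vs = det_on (arc_sign T) vs"
      by (rule det_on_cong) (use H(2) vs(1) in \<open>simp add: arc_sign_def induced_subgraph_def\<close>)
    ultimately show "tournament_det H \<le> K\<^sup>2" by simp
  qed
  then show ?thesis by (auto simp: det_class_def)
qed

text \<open>The factor \<open>c = 1\<close> stands for covertices and \<open>c = -1\<close> for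
  revertices.\<close>

lemma CR_associatedI:
  assumes "tournament T" "u \<in> pverts T" "v \<in> pverts T" "u \<noteq> v" "c \<in> {1, -1}"
    and "\<And>y. y \<in> pverts T \<Longrightarrow> y \<noteq> u \<Longrightarrow> y \<noteq> v \<Longrightarrow> arc_sign T u y = c * arc_sign T v y"
  shows "CR_associated T u v"
proof -
  have "theta T u y = c * theta T v y" if "y \<in> pverts T - {u, v}" for y
    using assms(6)[of y] that arc_sign_eq_theta[OF assms(1,2), of y]
      arc_sign_eq_theta[OF assms(1,3), of y] by auto
  then show ?thesis
    using assms(2-5) by (auto simp: CR_associated_def covertices_def revertices_def)
qed

lemma alt_sum_parity: "(\<And>v. v \<in> set L \<Longrightarrow> odd (f v)) \<Longrightarrow> even (alt_sum f L) \<longleftrightarrow> even (length L)"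
  by (induction L) auto

section \<open>Alternating sums of the apex signs and transversals of the runs\<close>

context run_numbering begin

text \<open>With \<open>d = R - rho v\<close>, the interval from \<open>- d\<close> to
  \<open>d + 1\<close> is invariant under replacing s by 1 - s, the effect of one more vertex of the
  same run. A vertex from an earlier run may also give 1 + s, but then \<open>d\<close>
  grows.\<close>

lemma alt_sum_sign_bounds:
  "sorted_wrt (<) (v # L) \<Longrightarrow> (\<And>i. i \<in> set (v # L) \<Longrightarrow> rho i \<le> R) \<Longrightarrow>
    - (R - rho v) \<le> sg (rho v) * alt_sum (\<lambda>i. sg (rho i)) (v # L)
    \<and> sg (rho v) * alt_sum (\<lambda>i. sg (rho i)) (v # L) \<le> R - rho v + 1"
proof (induction L arbitrary: v)
  case (Cons u L)
  define s where "s = sg (rho u) * alt_sum (\<lambda>i. sg (rho i)) (u # L)"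
  have IH: "- (R - rho u) \<le> s \<and> s \<le> R - rho u + 1"
    unfolding s_def using Cons.prems by (intro Cons.IH) auto
  have alt: "alt_sum (\<lambda>i. sg (rho i)) (u # L) = sg (rho u) * s"
    unfolding s_def by simp
  have eq: "sg (rho v) * alt_sum (\<lambda>i. sg (rho i)) (v # u # L) = 1 - sg (rho v) * sg (rho u) * s"
    unfolding alt_sum.simps(2)[of _ v] alt by (simp add: right_diff_distrib)
  have "rho v \<le> rho u" using Cons.prems by (intro rho_le) auto
  then consider "rho v = rho u" | "rho v + 1 \<le> rho u" by linarith
  then show ?case
  proof cases
    case 1
    then show ?thesis unfolding eq using IH by simp
  next
    case 2
    then show ?thesis unfolding eq using IH sg_cases[of "rho v"] sg_cases[of "rho u"] by auto
  qed
qed simp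

lemma alt_sum_sign_bounded:
  assumes "sorted_wrt (<) L" "set L \<subseteq> {0..<N}" "odd (length L)"
  shows "\<bar>alt_sum (\<lambda>i. sg (rho i)) L\<bar> \<le> k"
proof -
  obtain v M where L: "L = v # M" using assms(3) by (cases L) auto
  have "rho i \<le> rho 0 + k" if "i \<in> set L" for i
    using that assms(2) rho_le[of i "0 + N"] unfolding rho_period by auto
  moreover have "rho 0 \<le> rho v" using assms(2) L by (intro rho_le) auto
  ultimately have *: "\<bar>sg (rho v) * alt_sum (\<lambda>i. sg (rho i)) L\<bar> \<le> k + 1"
    using alt_sum_sign_bounds[of v M "rho 0 + k"] assms(1) unfolding L by auto
  have "\<bar>alt_sum (\<lambda>i. sg (rho i)) L\<bar> \<le> k + 1"
    using * sg_cases[of "rho v"] by auto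
  \<comment> \<open>The window can meet \<open>k + 1\<close> runs, but \<open>k + 1\<close> is even
    and so is not attained.\<close>
  moreover have "odd (alt_sum (\<lambda>i. sg (rho i)) L)"
    using assms(3) by (subst alt_sum_parity) (auto simp: sg_def)
  ultimately show ?thesis using k(1) by presburger
qed

text \<open>Picking one vertex from each of \<open>k\<close> consecutive runs matches the
  alternation of the sum with that of the apex signs. For the apex signs themselves the sum is
  therefore \<open>s * k\<close>.\<close>

lemma transversal:
  assumes "0 \<le> i" "i < N"
  obtains L s where "sorted_wrt (<) L" "set L \<subseteq> {0..<N}" "i \<in> set L" "int (length L) = k"
    "s \<in> {1, -1}" "\<And>h. alt_sum h L = s * (\<Sum>j \<in> set L. sg (rho j) * h j)"
proof -
  \<comment> \<open>The window may cut a run in two and then meets \<open>k + 1\<close> runs; the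
    first one is dropped only if \<open>i\<close> lies in the last.\<close>
  define a where "a = (if rho i < rho 0 + k then rho 0 else rho 0 + 1)"
  have rho_i: "rho 0 \<le> rho i" "rho i \<le> rho 0 + k"
    using rho_le[of 0 i] rho_le[of i "0 + N"] assms unfolding rho_period by simp_all
  have ai: "a \<le> rho i" "rho i \<le> a + k - 1" using rho_i k by (auto simp: a_def)
  have ex: "\<exists>l. 0 \<le> l \<and> l < N \<and> rho l = r" if "a \<le> r" "r \<le> a + k - 1" for r
  proof (cases "r < rho 0 + k")
    case True
    have rhoN: "rho N = rho 0 + k" using rho_period[of 0] by simp
    have "\<exists>l. 0 \<le> l \<and> l \<le> N \<and> rho l = r"
      using True that rhoN N by (intro rho_intermediate) (auto simp: a_def split: if_splits)
    then obtain l where l: "0 \<le> l" "l \<le> N" "rho l = r" by blast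
    then have "l \<noteq> N" using True rhoN by auto
    then show ?thesis using l by (intro exI[of _ l]) simp
  next
    case False
    then have "r = rho i" using that rho_i by (auto simp: a_def split: if_splits)
    then show ?thesis using assms by blast
  qed
  then obtain f0 where f0: "\<And>r. a \<le> r \<Longrightarrow> r \<le> a + k - 1 \<Longrightarrow> 0 \<le> f0 r \<and> f0 r < N \<and> rho (f0 r) = r"
    by metis
  define f where "f = f0(rho i := i)"
  have f: "0 \<le> f r" "f r < N" "rho (f r) = r" if "a \<le> r" "r \<le> a + k - 1" for r
    using f0[OF that] assms by (auto simp: f_def)
  have inj: "inj_on f {a..a+k-1}" by (rule inj_on_inverseI[of _ rho]) (simp add: f)
  show thesis
  proof (rule that[of "map f [a..a+k-1]" "sg a"])
    have "sorted_wrt (\<lambda>x y. f x < f y) [a..a+k-1]"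
      by (rule sorted_wrt_mono_rel[OF _ sorted_wrt_upto]) (rule rho_less, simp add: f)
    then show "sorted_wrt (<) (map f [a..a+k-1])" by (simp add: sorted_wrt_map)
    show "set (map f [a..a+k-1]) \<subseteq> {0..<N}" using f by auto
    have "f (rho i) = i" by (simp add: f_def)
    then show "i \<in> set (map f [a..a+k-1])" using ai by force
    show "int (length (map f [a..a+k-1])) = k" using k by simp
    show "sg a \<in> {1, -1}" using sg_cases[of a] by auto
    fix h :: "int \<Rightarrow> int"
    have "alt_sum h (map f [a..a+k-1]) = sg a * (\<Sum>r = a..a+k-1. sg r * h (f r))"
      using k by (simp add: alt_sum_map alt_sum_upto)
    also have "(\<Sum>r = a..a+k-1. sg r * h (f r)) = (\<Sum>r = a..a+k-1. sg (rho (f r)) * h (f r))"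
      by (rule sum.cong) (auto simp: f)
    also have "\<dots> = (\<Sum>j \<in> f ` {a..a+k-1}. sg (rho j) * h j)"
      by (simp add: sum.reindex[OF inj])
    finally show "alt_sum h (map f [a..a+k-1])
      = sg a * (\<Sum>j \<in> set (map f [a..a+k-1]). sg (rho j) * h j)" by simp
  qed
qed

end

text \<open>The case \<open>p = q\<close> is the one of a single apex.\<close>

locale line_with_apexes = run_numbering N k rho
  for N k :: int and rho :: "int \<Rightarrow> int" +
  fixes T :: "'a::infinite pair_pre_digraph" and t :: "int \<Rightarrow> 'a" and p q :: 'a
  assumes tournament: "tournament T"
    and pverts: "pverts T = insert p (insert q (t ` {0..<N}))"
    and inj: "inj_on t {0..<N}"
    and apex_notin: "p \<notin> t ` {0..<N}" "q \<notin> t ` {0..<N}"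
    and line_arc: "0 \<le> i \<Longrightarrow> i < j \<Longrightarrow> j < N \<Longrightarrow> (t i, t j) \<in> parcs T"
    and apex_arc: "0 \<le> i \<Longrightarrow> i < N \<Longrightarrow> (p, t i) \<in> parcs T \<longleftrightarrow> even (rho i)"
      "0 \<le> i \<Longrightarrow> i < N \<Longrightarrow> (q, t i) \<in> parcs T \<longleftrightarrow> even (rho i)"
    and apexes_arc: "p \<noteq> q \<Longrightarrow> (p, q) \<in> parcs T"
begin

lemma t_in: "0 \<le> i \<Longrightarrow> i < N \<Longrightarrow> t i \<in> pverts T"
  and p_in: "p \<in> pverts T" and q_in: "q \<in> pverts T"
  by (auto simp: pverts)

lemma t_neq: "0 \<le> i \<Longrightarrow> i < N \<Longrightarrow> t i \<noteq> p" "0 \<le> i \<Longrightarrow> i < N \<Longrightarrow> t i \<noteq> q"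
  using apex_notin by auto

lemma line_sign: "0 \<le> i \<Longrightarrow> i < j \<Longrightarrow> j < N \<Longrightarrow> arc_sign T (t i) (t j) = 1"
  by (simp add: arc_sign_def line_arc)

lemma apex_sign:
  assumes "0 \<le> i" "i < N"
  shows "arc_sign T p (t i) = sg (rho i)" "arc_sign T q (t i) = sg (rho i)"
  using arc_sign_eq_theta[OF tournament p_in t_in, of i] arc_sign_eq_theta[OF tournament q_in t_in, of i]
    t_neq[OF assms] apex_arc[OF assms] assms
  by (auto simp: theta_def sg_def)

lemma apexes_sign: "p \<noteq> q \<Longrightarrow> arc_sign T p q = 1"
  by (simp add: arc_sign_def apexes_arc)

lemma map_line:
  assumes "sorted_wrt (<) L" "set L \<subseteq> {0..<N}"
  shows "transitive_list (arc_sign T) (map t L)" "distinct (map t L)"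
    "set (map t L) \<subseteq> pverts T" "p \<notin> set (map t L)" "q \<notin> set (map t L)"
proof -
  have "sorted_wrt (\<lambda>i j. arc_sign T (t i) (t j) = 1) L"
  proof (rule sorted_wrt_mono_rel[OF _ assms(1)])
    fix i j assume "i \<in> set L" "j \<in> set L" "i < j"
    then have "0 \<le> i" "i < j" "j < N" using assms(2) by auto
    then show "arc_sign T (t i) (t j) = 1" by (rule line_sign)
  qed
  then show "transitive_list (arc_sign T) (map t L)" by (simp add: sorted_wrt_map)
  show "distinct (map t L)"
    using assms strict_sorted_imp_sorted strict_sorted_iff inj_on_subset[OF inj]
    by (auto simp: distinct_map strict_sorted_iff)
  show "set (map t L) \<subseteq> pverts T" "p \<notin> set (map t L)" "q \<notin> set (map t L)"
    using assms(2) apex_notin by (auto simp: pverts)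
qed

text \<open>Odd orders give 0. For even orders the determinant is 1 without an apex, the square of
  an alternating sum of apex signs with one apex, and 1 with both, because their equal rows have
  border sum 0.\<close>

lemma det_on_bounded:
  assumes vs: "distinct vs" "set vs \<subseteq> pverts T"
  shows "det_on (arc_sign T) vs \<le> k\<^sup>2"
proof (cases "even (length vs)")
  case False
  then show ?thesis using det_on_skew_odd[OF skew_arc_sign[OF tournament]] by simp
next
  case even: True
  have k1: "1 \<le> k\<^sup>2" using k zero_less_power[of k 2] by linarith
  define J where "J = {i \<in> {0..<N}. t i \<in> set vs}"
  define L where "L = sorted_list_of_set J"
  have finJ: "finite J" by (rule finite_subset[of _ "{0..<N}"]) (auto simp: J_def)
  have L: "sorted_wrt (<) L" "set L \<subseteq> {0..<N}" "set (map t L) = set vs - {p, q}"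
    using vs(2) t_neq finJ strict_sorted_list_of_set
    by (auto simp: L_def J_def pverts)
  note mapL = map_line[OF L(1,2)]
  note skew = skew_arc_sign[OF tournament]
  have perm: "det_on (arc_sign T) vs = det_on (arc_sign T) (map t L @ ws)"
    if "distinct ws" "set ws = set vs \<inter> {p, q}" for ws
  proof -
    have "distinct (map t L @ ws)" "set (map t L @ ws) = set vs"
      using mapL that L(3) by auto
    then have "mset vs = mset (map t L @ ws)"
      using vs(1) set_eq_iff_mset_eq_distinct by metis
    then show ?thesis by (rule det_on_perm)
  qed
  have len: "even (length L + length ws)" if "distinct ws" "set ws = set vs \<inter> {p, q}" for ws
  proof -
    have "distinct (map t L @ ws)" "set (map t L @ ws) = set vs"
      using mapL that L(3) by auto
    then have "length vs = length (map t L @ ws)"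
      using vs(1) by (metis distinct_card)
    then show ?thesis using even by simp
  qed
  have apex_alt: "alt_sum (arc_sign T a) (map t L) = alt_sum (\<lambda>i. sg (rho i)) L"
    if "a \<in> {p, q}" for a
    unfolding alt_sum_map using that L(2) apex_sign by (intro alt_sum_cong) auto
  consider (none) "set vs \<inter> {p, q} = {}" | (one) a where "set vs \<inter> {p, q} = {a}"
    | (two) "set vs \<inter> {p, q} = {p, q}" "p \<noteq> q" by blast
  then show ?thesis
  proof cases
    case none
    then have "det_on (arc_sign T) vs = 1"
      using perm[of "[]"] len[of "[]"] det_on_transitive[OF skew _ mapL(1)] by simp
    then show ?thesis using k1 by simp
  next
    case (one a)
    have "odd (length L)" using len[of "[a]"] one by simp
    moreover have "a \<in> {p, q}" using one by blast
    ultimately have "det_on (arc_sign T) vs = (alt_sum (\<lambda>i. sg (rho i)) L)\<^sup>2"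
      using perm[of "[a]"] one det_on_transitive_apex[OF skew _ mapL(1)] apex_alt[of a] by simp
    also have "\<dots> \<le> k\<^sup>2"
      using alt_sum_sign_bounded[OF L(1,2) \<open>odd (length L)\<close>] k abs_le_square_iff[of _ k] by simp
    finally show ?thesis .
  next
    case two
    have "even (length L)" using len[of "[p, q]"] two by simp
    moreover have "border_sum (arc_sign T q) (arc_sign T p) (map t L)
        = border_sum (arc_sign T p) (arc_sign T p) (map t L)"
      using L(2) apex_sign by (intro border_sum_cong) auto
    ultimately have "det_on (arc_sign T) vs = 1"
      using perm[of "[p, q]"] two det_on_bordered_transitive[OF skew _ mapL(1), of p q]
      by (simp add: border_sum_same apexes_sign)
    then show ?thesis using k1 by simp
  qed
qed

lemma in_det_class: "T \<in> det_class k"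
  using tournament k det_on_bounded by (auto simp: det_class_iff)

lemma not_in_smaller_det_class: "T \<notin> det_class (k - 2)"
proof
  assume T: "T \<in> det_class (k - 2)"
  obtain L s where L: "sorted_wrt (<) L" "set L \<subseteq> {0..<N}" "int (length L) = k" "s \<in> {1, -1}"
    "\<And>h. alt_sum h L = s * (\<Sum>j \<in> set L. sg (rho j) * h j)"
    by (rule transversal[OF order_refl N], rule that)
  note mapL = map_line[OF L(1,2)]
  have "distinct L" using L(1) by (simp add: strict_sorted_iff)
  have alt: "alt_sum (\<lambda>i. sg (rho i)) L = s * k"
    using L(3) distinct_card[OF \<open>distinct L\<close>] by (simp add: L(5))
  have "odd (length L)" using k L(3) by (metis even_of_nat)
  have "det_on (arc_sign T) (map t L @ [p]) = (alt_sum (arc_sign T p) (map t L))\<^sup>2"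
    by (rule det_on_transitive_apex[OF skew_arc_sign[OF tournament] _ mapL(1)])
      (simp add: \<open>odd (length L)\<close>)
  also have "alt_sum (arc_sign T p) (map t L) = alt_sum (\<lambda>i. sg (rho i)) L"
    unfolding alt_sum_map using L(2) apex_sign by (intro alt_sum_cong) auto
  also have "(\<dots>)\<^sup>2 = k\<^sup>2" using alt L(4) by (auto simp: power_mult_distrib)
  finally have "det_on (arc_sign T) (map t L @ [p]) = k\<^sup>2" .
  then have "k\<^sup>2 \<le> (k - 2)\<^sup>2"
  proof -
    have "distinct (map t L @ [p])" "map t L @ [p] \<noteq> []" "set (map t L @ [p]) \<subseteq> pverts T"
      using mapL p_in by auto
    then have "det_on (arc_sign T) (map t L @ [p]) \<le> (k - 2)\<^sup>2"
      using T unfolding det_class_iff by blast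
    then show ?thesis using \<open>det_on (arc_sign T) (map t L @ [p]) = k\<^sup>2\<close> by simp
  qed
  \<comment> \<open>This excludes \<open>k = 1\<close>, where both squares agree.\<close>
  moreover have "1 \<le> k - 2" using T unfolding det_class_iff by blast
  ultimately show False by (simp add: power2_eq_square algebra_simps)
qed

text \<open>If \<open>u\<close> has the same sign towards both apexes,
  \<open>extension_cases\<close> for \<open>p\<close> names the associated vertex. If the signs
  differ, only signs towards the line opposite to the pattern of \<open>p\<close> scaled by
  \<open>A u p\<close> survive, and \<open>u\<close> is then associated with
  \<open>p\<close>.\<close>

lemma extension_CR_vertex:
  assumes u: "u \<notin> pverts T" and B_def: "B = extend_tournament T u \<sigma>" and B: "B \<in> det_class k"
  shows "CR_vertex T u \<sigma>"
proof -
  define A where "A = arc_sign B"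
  have tourB: "tournament B"
    and bnd: "\<And>vs. distinct vs \<Longrightarrow> vs \<noteq> [] \<Longrightarrow> set vs \<subseteq> pverts B \<Longrightarrow> det_on A vs \<le> k\<^sup>2"
    using B unfolding det_class_iff A_def by blast+
  have skew: "skew A" unfolding A_def by (rule skew_arc_sign[OF tourB])
  have pvB: "pverts B = insert u (pverts T)" by (simp add: B_def extend_tournament_def)
  have uB: "u \<in> pverts B" by (simp add: pvB)
  have A_T: "A v y = arc_sign T v y" if "v \<in> pverts T" "y \<in> pverts T" for v y
  proof -
    have "v \<noteq> u" "y \<noteq> u" using that u by auto
    then show ?thesis by (auto simp: A_def arc_sign_def B_def extend_tournament_def)
  qed
  have A_line: "A (t i) (t j) = 1" if "0 \<le> i" "i < j" "j < N" for i j
    using line_sign[OF that] A_T[of "t i" "t j"] t_in that by simp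
  have A_transitive: "transitive_list A (map t L)"
    if "sorted_wrt (<) L" "set L \<subseteq> {0..<N}" for L
    unfolding sorted_wrt_map
  proof (rule sorted_wrt_mono_rel[OF _ that(1)])
    fix i j assume "i \<in> set L" "j \<in> set L" "i < j"
    then have "0 \<le> i" "i < j" "j < N" using that(2) by auto
    then show "A (t i) (t j) = 1" by (rule A_line)
  qed
  have A_line': "A (t i) (t j) = -1" if "0 \<le> j" "j < i" "i < N" for i j
    using A_line[OF that] skewD[OF skew, of "t i" "t j"] by simp
  have A_p: "A p (t i) = sg (rho i)" and A_q: "A q (t i) = sg (rho i)" if "0 \<le> i" "i < N" for i
    using apex_sign[OF that] A_T t_in[OF that] p_in q_in by simp_all
  have A_pq: "A p q = 1" "A q p = -1" if "p \<noteq> q"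
    using apexes_sign[OF that] A_T[OF p_in q_in] skewD[OF skew, of q p] by simp_all
  have A_u: "A u v \<in> {1, -1}" if "v \<in> pverts T" for v
    unfolding A_def by (rule arc_sign_values[OF tourB uB]) (use that u in \<open>auto simp: pvB\<close>)
  have CR: "CR_vertex T u \<sigma>"
    if "v \<in> pverts T" "c \<in> {1, -1}"
      and agree: "\<And>i. 0 \<le> i \<Longrightarrow> i < N \<Longrightarrow> t i \<noteq> v \<Longrightarrow> A u (t i) = c * A v (t i)"
        "p \<noteq> v \<Longrightarrow> A u p = c * A v p" "q \<noteq> v \<Longrightarrow> A u q = c * A v q" for v c
  proof -
    have "CR_associated B u v"
    proof (rule CR_associatedI[OF tourB uB _ _ that(2)])
      show "v \<in> pverts B" "u \<noteq> v" using that(1) u by (auto simp: pvB)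
      fix y assume y: "y \<in> pverts B" "y \<noteq> u" "y \<noteq> v"
      then consider "y = p" | "y = q" | i where "y = t i" "0 \<le> i" "i < N"
        by (auto simp: pvB pverts)
      then show "arc_sign B u y = c * arc_sign B v y"
        unfolding A_def[symmetric] using agree y by cases auto
    qed
    then show ?thesis using that(1) unfolding CR_vertex_def B_def by blast
  qed

  define z where "z i = sg (i div N) * A u (t (i mod N))" for i
  have z_window: "z i = A u (t i)" if "0 \<le> i" "i < N" for i
    using that by (simp add: z_def)
  interpret bounded_extension N k rho z "A u p"
  proof
    show z_ap: "antiperiodic N z"
      using N by (simp add: antiperiodic_def z_def sg_add)
    show "z i \<in> {1, -1}" for i
      using A_u[OF t_in[of "i mod N"]] N sg_cases[of "i div N"] by (auto simp: z_def)
    show "A u p \<in> {1, -1}" using A_u p_in by blast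
    show "window_bounded (\<lambda>i. sg (rho i)) z (A u p) N k"
    proof (rule window_boundedI[OF N antiperiodic_sign z_ap])
      fix L :: "int list" assume L: "sorted_wrt (<) L" "even (length L)" "set L \<subseteq> {0..<N}"
      note mapL = map_line[OF L(1,3)]
      have "det_on A (map t L @ [u, p]) = (A u p + border_sum (A p) (A u) (map t L))\<^sup>2"
        using L(2) A_transitive[OF L(1,3)] by (intro det_on_bordered_transitive[OF skew]) simp_all
      also have "border_sum (A p) (A u) (map t L) = border_sum (\<lambda>i. sg (rho i)) z L"
        unfolding border_sum_map using L(3) by (intro border_sum_cong) (auto simp: A_p z_window)
      finally have det: "det_on A (map t L @ [u, p]) = (A u p + border_sum (\<lambda>i. sg (rho i)) z L)\<^sup>2" .
      have "distinct (map t L @ [u, p])" "set (map t L @ [u, p]) \<subseteq> pverts B"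
        using mapL u p_in by (auto simp: pvB)
      then have "(A u p + border_sum (\<lambda>i. sg (rho i)) z L)\<^sup>2 \<le> k\<^sup>2"
        using bnd[of "map t L @ [u, p]"] det by simp
      then show "\<bar>A u p + border_sum (\<lambda>i. sg (rho i)) z L\<bar> \<le> k"
        using k abs_le_square_iff[of _ k] by simp
    qed
  qed

  show ?thesis
  proof (cases "A u p = A u q")
    case same: True
    show ?thesis
    proof (rule extension_cases)
      fix c assume c: "c \<in> {1, -1}" "\<And>i. z i = c * sg (rho i)"
      have points: "A u (t i) = c * sg (rho i)" if "0 \<le> i" "i < N" for i
        using c(2)[of i] z_window[OF that] by simp
      show ?thesis
      \<comment> \<open>For two apexes, \<open>p\<close> has sign 1 towards \<open>q\<close> and
        \<open>q\<close> has sign -1 towards \<open>p\<close>; the sign of \<open>u\<close> decides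
        which of them it is associated with.\<close>
      proof (cases "A u p = c")
        case True
        show ?thesis
          by (rule CR[OF p_in c(1)]) (use points A_p A_pq same True in auto)
      next
        case False
        then have "A u p = - c" using A_u[OF p_in] c(1) by auto
        show ?thesis
        proof (cases "p = q")
          case True
          show ?thesis by (rule CR[OF p_in c(1)]) (use points A_p True in auto)
        next
          case False
          show ?thesis
            by (rule CR[OF q_in c(1)]) (use points A_q A_pq False \<open>A u p = - c\<close> in auto)
        qed
      qed
    next
      fix j c assume c: "c \<in> {1, -1}" "A u p = - c * sg (rho j)"
        and const: "\<And>i. j < i \<Longrightarrow> i < j + N \<Longrightarrow> z i = c"
      \<comment> \<open>The vertex \<open>j\<close> is moved into the actual line; \<open>d\<close>
        absorbs the sign from the periods crossed.\<close>
      define j0 m where "j0 = j mod N" and "m = j div N"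
      define d where "d = sg m * c"
      have j: "j = j0 + m * N" by (simp add: j0_def m_def)
      have j0: "0 \<le> j0" "j0 < N" using N by (simp_all add: j0_def)
      have d: "d \<in> {1, -1}" using c(1) sg_cases[of m] by (auto simp: d_def)
      have zd: "z i = d" if "j0 < i" "i < j0 + N" for i
      proof -
        have "z (i + m * N) = c" using that by (intro const) (simp_all add: j)
        then show ?thesis
          unfolding antiperiodic_mult[OF z_antiperiodic] by (auto simp: d_def)
      qed
      have "sg (m * k) = sg m" using k by (simp add: sg_def)
      then have up: "A u p = - d * sg (rho j0)"
        using c(2) unfolding j rho_shift by (simp add: d_def sg_add mult_ac)
      show ?thesis
      proof (rule CR[OF t_in[OF j0] d])
        fix i assume i: "0 \<le> i" "i < N" "t i \<noteq> t j0"
        then consider "i < j0" | "j0 < i" by (cases i j0 rule: linorder_cases) auto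
        then show "A u (t i) = d * A (t j0) (t i)"
        proof cases
          case 1
          then have "z (i + N) = d" using i by (intro zd) (use j0 in simp_all)
          then show ?thesis using 1 i j0 z_add[of i] A_line'[of i j0] z_window[of i] by simp
        next
          case 2
          then show ?thesis using i j0 zd[of i] A_line[of j0 i] z_window[of i] by simp
        qed
      next
        show "A u p = d * A (t j0) p"
          using up A_p[OF j0] skewD[OF skew, of "t j0" p] by simp
        show "A u q = d * A (t j0) q"
          using up same A_q[OF j0] skewD[OF skew, of "t j0" q] by simp
      qed
    qed
  next
    case False
    then have pq: "p \<noteq> q" by auto
    define w where "w = A u p"
    have w: "w \<in> {1, -1}" "A u q = - w"
      using A_u[OF p_in] A_u[OF q_in] False by (auto simp: w_def)
    show ?thesis
    proof (cases "\<forall>i. 0 \<le> i \<and> i < N \<longrightarrow> A u (t i) = - w * sg (rho i)")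
      case True
      show ?thesis
        by (rule CR[OF p_in, of "- w"]) (use True w A_p A_pq pq in auto)
    next
      case False
      then obtain i where i: "0 \<le> i" "i < N" "A u (t i) \<noteq> - w * sg (rho i)" by blast
      obtain L s where L: "sorted_wrt (<) L" "set L \<subseteq> {0..<N}" "i \<in> set L" "int (length L) = k"
        "s \<in> {1, -1}" "\<And>h. alt_sum h L = s * (\<Sum>j \<in> set L. sg (rho j) * h j)"
        by (rule transversal[OF i(1,2)], rule that)
      note mapL = map_line[OF L(1,2)]
      have oddL: "odd (length L)" using k L(4) by (metis even_of_nat)
      have "distinct L" using L(1) by (simp add: strict_sorted_iff)
      then have cardL: "int (card (set L)) = k" using L(4) by (simp add: distinct_card)
      \<comment> \<open>Up to the factor \<open>w\<close>, these are the terms of the alternating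
        sum after pivoting on the two apexes. They are 1 or 3, and 3 at \<open>i\<close>, so the
        \<open>k\<close> terms add up to at least \<open>k + 2\<close>.\<close>
      define g where "g j = 2 + w * sg (rho j) * A u (t j)" for j
      have g1: "1 \<le> g j" if "j \<in> set L" for j
      proof -
        have "t j \<in> pverts T" using that L(2) t_in by auto
        then show ?thesis
          using A_u[of "t j"] w(1) sg_cases[of "rho j"] by (auto simp: g_def)
      qed
      have "g i = 3"
        using i(3) A_u[OF t_in[OF i(1,2)]] w(1) sg_cases[of "rho i"] by (auto simp: g_def)
      moreover have "sum g (set L) = g i + sum g (set L - {i})"
        using L(3) by (simp add: sum.remove)
      moreover have "(\<Sum>j \<in> set L - {i}. 1) \<le> sum g (set L - {i})"
        by (rule sum_mono) (use g1 in auto)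
      ultimately have "k + 2 \<le> sum g (set L)"
        using cardL L(3) by (simp add: card_Diff_singleton_if of_nat_diff card_gt_0_iff Suc_le_eq)
      moreover have "det_on A (p # q # map t L @ [u]) = (sum g (set L))\<^sup>2"
      proof -
        have "det_on A (p # q # map t L @ [u])
            = (alt_sum (\<lambda>v. A u v + (A u p - A u q) * A p v) (map t L))\<^sup>2"
        proof (rule det_on_transitive_twin_apexes[OF skew _ A_transitive[OF L(1,2)]])
          fix v assume "v \<in> set (map t L)"
          then show "A q v = A p v" using L(2) A_p A_q by auto
        qed (use oddL A_pq pq in simp_all)
        also have "alt_sum (\<lambda>v. A u v + (A u p - A u q) * A p v) (map t L)
            = s * (\<Sum>j \<in> set L. sg (rho j) * (A u (t j) + 2 * w * A p (t j)))"
          unfolding alt_sum_map L(6) using w by (simp add: w_def)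
        also have "(\<Sum>j \<in> set L. sg (rho j) * (A u (t j) + 2 * w * A p (t j))) = (\<Sum>j \<in> set L. w * g j)"
        proof (rule sum.cong)
          fix j assume "j \<in> set L"
          then have "A p (t j) = sg (rho j)" using L(2) A_p by auto
          then show "sg (rho j) * (A u (t j) + 2 * w * A p (t j)) = w * g j"
            using w(1) sg_cases[of "rho j"] by (auto simp: g_def)
        qed simp
        also have "(s * (\<Sum>j \<in> set L. w * g j))\<^sup>2 = (sum g (set L))\<^sup>2"
          using L(5) w(1) by (auto simp: power_mult_distrib simp flip: sum_distrib_left)
        finally show ?thesis .
      qed
      moreover have "det_on A (p # q # map t L @ [u]) \<le> k\<^sup>2"
        by (rule bnd) (use mapL pq u p_in q_in in \<open>auto simp: pvB\<close>)
      ultimately have "(k + 2)\<^sup>2 \<le> k\<^sup>2"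
        using power_mono[of "k + 2" "sum g (set L)" 2] k by simp
      then show ?thesis using k by (simp add: power2_eq_square algebra_simps)
    qed
  qed
qed

theorem CR_tournament: "CR_tournament T"
  unfolding CR_tournament_def
  using k in_det_class not_in_smaller_det_class extension_CR_vertex by (intro exI[of _ k]) auto

end

section \<open>The tournaments \<open>L\<^sub>n\<close> and their blowups\<close>

text \<open>The last hypothesis is the step across the seam of two periods.\<close>

lemma run_numbering_quasi_ext:
  assumes "odd k" "0 < k" "0 < N"
    and "\<And>i. 0 \<le> i \<Longrightarrow> i + 1 < N \<Longrightarrow> r (i + 1) = r i \<or> r (i + 1) = r i + 1"
    and "r 0 + k = r (N - 1) \<or> r 0 + k = r (N - 1) + 1"
  shows "run_numbering N k (quasi_ext 0 N k r)"
proof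
  fix i
  show "quasi_ext 0 N k r (i + 1) = quasi_ext 0 N k r i
      \<or> quasi_ext 0 N k r (i + 1) = quasi_ext 0 N k r i + 1"
    by (rule quasi_ext_step[OF assms(3), of 0 k r i]) (use assms(4,5) in force)+
qed (use assms in \<open>simp_all add: quasi_ext_add\<close>)

lemma tournament_L:
  assumes "2 \<le> n"
  shows "tournament (L_tournament n)"
  unfolding tournament_iff
proof (intro conjI ballI allI impI)
  fix u v assume "u \<in> pverts (L_tournament n)" "v \<in> pverts (L_tournament n)" "u \<noteq> v"
  then show "(u, v) \<in> parcs (L_tournament n) \<longleftrightarrow> (v, u) \<notin> parcs (L_tournament n)"
    by (cases u v rule: linorder_cases) (auto simp: L_tournament_def)
qed (use assms in \<open>auto simp: L_tournament_def\<close>)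

lemma tournament_blowup:
  assumes "tournament T" "\<And>v. v \<in> pverts T \<Longrightarrow> 1 \<le> a v"
  shows "tournament (transitive_blowup T a)"
  unfolding tournament_iff
proof (intro conjI ballI allI impI)
  show "finite (pverts (transitive_blowup T a))"
    using tournamentD(1)[OF assms(1)] by (simp add: transitive_blowup_def)
  obtain v where "v \<in> pverts T" using tournamentD(2)[OF assms(1)] by blast
  then have "(v, 1) \<in> pverts (transitive_blowup T a)"
    using assms(2) by (simp add: transitive_blowup_def)
  then show "pverts (transitive_blowup T a) \<noteq> {}" by blast
  show "parcs (transitive_blowup T a)
      \<subseteq> pverts (transitive_blowup T a) \<times> pverts (transitive_blowup T a)"
    by (auto simp: transitive_blowup_def)
  show "(x, x) \<notin> parcs (transitive_blowup T a)" for x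
    using tournamentD(4)[OF assms(1)] by (auto simp: transitive_blowup_def)
  fix x y
  assume *: "x \<in> pverts (transitive_blowup T a)" "y \<in> pverts (transitive_blowup T a)" "x \<noteq> y"
  obtain v i w j where x: "x = (v, i)" and y: "y = (w, j)" by (cases x, cases y)
  show "(x, y) \<in> parcs (transitive_blowup T a) \<longleftrightarrow> (y, x) \<notin> parcs (transitive_blowup T a)"
  proof (cases "v = w")
    case True
    then show ?thesis
      using * tournamentD(4)[OF assms(1), of w] by (auto simp: x y transitive_blowup_def)
  next
    case False
    then show ?thesis
      using * tournamentD(5)[OF assms(1), of v w] by (auto simp: x y transitive_blowup_def)
  qed
qed

lemma L_arcs:
  assumes "2 \<le> n"
  shows "1 \<le> i \<Longrightarrow> i < j \<Longrightarrow> j < n \<Longrightarrow> (i, j) \<in> parcs (L_tournament n)"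
    and "1 \<le> i \<Longrightarrow> i < n \<Longrightarrow> (n, i) \<in> parcs (L_tournament n) \<longleftrightarrow> odd i"
  using assms by (auto simp: L_tournament_def)

text \<open>The apex signs alternate along all \<open>n - 1\<close> line vertices. For odd
  \<open>n\<close> the last sign equals the negated first one, so two runs merge in the antiperiodic
  continuation.\<close>

definition L_runs :: "nat \<Rightarrow> int" where
  "L_runs n = (if even n then int n - 1 else int n - 2)"

lemma L_runs:
  assumes "2 \<le> n"
  shows "odd (L_runs n)" "0 < L_runs n" "L_runs n = int n - 1 \<or> L_runs n = int n - 2"
  using assms by (auto simp: L_runs_def intro: Suc_leI dest: le_neq_implies_less)

lemma CR_L:
  assumes n: "2 \<le> n"
  shows "CR_tournament (L_tournament n)"
proof -
  define N where "N = int n - 1"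
  define rho where "rho = quasi_ext 0 N (L_runs n) (\<lambda>i. i)"
  have rho: "rho i = i" if "0 \<le> i" "i < N" for i
    using that by (simp add: rho_def quasi_ext_window)
  interpret run_numbering N "L_runs n" rho
    unfolding rho_def
    by (rule run_numbering_quasi_ext) (use L_runs[OF n] n in \<open>auto simp: N_def\<close>)
  \<comment> \<open>Line position \<open>i\<close> is vertex \<open>i + 1\<close>; the shift turns
    the odd out-neighbours of \<open>n\<close> into even run numbers.\<close>
  interpret line_with_apexes N "L_runs n" rho "L_tournament n" "\<lambda>i. nat (i + 1)" n n
  proof
    show "tournament (L_tournament n)" by (rule tournament_L[OF n])
    have "i \<in> (\<lambda>i. nat (i + 1)) ` {0..<N}" if "1 \<le> i" "i < n" for i
      by (rule image_eqI[of _ _ "int i - 1"]) (use that in \<open>auto simp: N_def\<close>)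
    then show "pverts (L_tournament n) = insert n (insert n ((\<lambda>i. nat (i + 1)) ` {0..<N}))"
      using n by (fastforce simp: L_tournament_def N_def)
    show "inj_on (\<lambda>i. nat (i + 1)) {0..<N}" by (auto simp: inj_on_def)
    show "n \<notin> (\<lambda>i. nat (i + 1)) ` {0..<N}" by (auto simp: N_def)
    show "(nat (i + 1), nat (j + 1)) \<in> parcs (L_tournament n)" if "0 \<le> i" "i < j" "j < N" for i j
      by (rule L_arcs(1)[OF n]) (use that in \<open>auto simp: N_def\<close>)
    show "(n, nat (i + 1)) \<in> parcs (L_tournament n) \<longleftrightarrow> even (rho i)" if "0 \<le> i" "i < N" for i
      using L_arcs(2)[OF n, of "nat (i + 1)"] that rho[OF that] by (simp add: N_def even_nat_iff)
  qed simp
  show ?thesis by (rule CR_tournament)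
qed

lemma blowup_arc_iff:
  assumes "v \<in> pverts T" "w \<in> pverts T" "i \<in> {1..a v}" "j \<in> {1..a w}"
  shows "((v, i), (w, j)) \<in> parcs (transitive_blowup T a) \<longleftrightarrow> (v, w) \<in> parcs T \<or> v = w \<and> i < j"
  using assms by (simp add: transitive_blowup_def)

lemma L_vertex: "1 \<le> i \<Longrightarrow> i \<le> n \<Longrightarrow> i \<in> pverts (L_tournament n)"
  by (simp add: L_tournament_def)

text \<open>The line and its run numbering are those of \<open>L_tournament n\<close>; only the apex
  is doubled.\<close>

lemma CR_L_blowup_apex:
  assumes n: "2 \<le> n" and a: "a n = 2" "\<And>w. w \<in> pverts (L_tournament n) \<Longrightarrow> w \<noteq> n \<Longrightarrow> a w = 1"
  shows "CR_tournament (transitive_blowup (L_tournament n) a)" (is "CR_tournament ?B")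
proof -
  define N where "N = int n - 1"
  define rho where "rho = quasi_ext 0 N (L_runs n) (\<lambda>i. i)"
  define t where "t i = (nat (i + 1), 1 :: nat)" for i
  have rho: "rho i = i" if "0 \<le> i" "i < N" for i
    using that by (simp add: rho_def quasi_ext_window)
  have a1: "a i = 1" if "1 \<le> i" "i < n" for i
    by (rule a(2)) (use that in \<open>auto simp: L_tournament_def\<close>)
  have ge1: "1 \<le> a i" if "i \<in> pverts (L_tournament n)" for i
    using a that by (cases "i = n") auto
  interpret run_numbering N "L_runs n" rho
    unfolding rho_def
    by (rule run_numbering_quasi_ext) (use L_runs[OF n] n in \<open>auto simp: N_def\<close>)
  interpret line_with_apexes N "L_runs n" rho ?B t "(n, 1)" "(n, 2)"
  proof
    show "tournament ?B" by (rule tournament_blowup[OF tournament_L[OF n] ge1])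
    have "(i, 1) \<in> t ` {0..<N}" if "1 \<le> i" "i < n" for i
      by (rule image_eqI[of _ _ "int i - 1"]) (use that in \<open>auto simp: N_def t_def\<close>)
    moreover have "pverts ?B = insert (n, 1) (insert (n, 2) {(i, 1) |i. 1 \<le> i \<and> i < n})"
    proof (rule Set.set_eqI)
      fix x :: "nat \<times> nat"
      obtain i j where x: "x = (i, j)" by (cases x)
      show "x \<in> pverts ?B \<longleftrightarrow> x \<in> insert (n, 1) (insert (n, 2) {(i, 1) |i. 1 \<le> i \<and> i < n})"
        using n a1[of i] a(1) by (cases "i < n") (auto simp: x transitive_blowup_def L_tournament_def)
    qed
    ultimately show "pverts ?B = insert (n, 1) (insert (n, 2) (t ` {0..<N}))"
      by (auto simp: t_def N_def)
    show "inj_on t {0..<N}" by (auto simp: inj_on_def t_def)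
    show "(n, 1) \<notin> t ` {0..<N}" "(n, 2) \<notin> t ` {0..<N}" by (auto simp: N_def t_def)
    show "(t i, t j) \<in> parcs ?B" if "0 \<le> i" "i < j" "j < N" for i j
    proof -
      have "(nat (i + 1), nat (j + 1)) \<in> parcs (L_tournament n)"
        by (rule L_arcs(1)[OF n]) (use that in \<open>auto simp: N_def\<close>)
      then show ?thesis
        unfolding t_def using that a1[of "nat (i+1)"] a1[of "nat (j+1)"]
        by (subst blowup_arc_iff) (auto simp: N_def intro!: L_vertex)
    qed
    have apex: "((n, l), t i) \<in> parcs ?B \<longleftrightarrow> even (rho i)" if "0 \<le> i" "i < N" "l \<in> {1, 2}" for i l
      unfolding t_def using that(3) that(1,2) a1[of "nat (i+1)"] a(1) n
        L_arcs(2)[OF n, of "nat (i + 1)"] rho[OF that(1,2)]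
      by (subst blowup_arc_iff) (auto simp: N_def even_nat_iff intro!: L_vertex)
    show "((n, 1), t i) \<in> parcs ?B \<longleftrightarrow> even (rho i)" "((n, 2), t i) \<in> parcs ?B \<longleftrightarrow> even (rho i)"
      if "0 \<le> i" "i < N" for i
      using that by (simp_all add: apex)
    show "((n, 1), (n, 2)) \<in> parcs ?B"
      using a(1) n by (subst blowup_arc_iff) (auto intro!: L_vertex)
  qed
  show ?thesis by (rule CR_tournament)
qed

text \<open>The line gains a vertex in the run of its twin, so the number of runs per period does
  not change.\<close>

lemma CR_L_blowup_line:
  assumes v: "1 \<le> v" "v < n"
    and a: "a v = 2" "\<And>w. w \<in> pverts (L_tournament n) \<Longrightarrow> w \<noteq> v \<Longrightarrow> a w = 1"
  shows "CR_tournament (transitive_blowup (L_tournament n) a)" (is "CR_tournament ?B")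
proof -
  have n: "2 \<le> n" using v by simp
  define N where "N = int n"
  \<comment> \<open>Position \<open>int v\<close> holds the second copy of \<open>v\<close>, and all
    later positions are shifted by one.\<close>
  define r where "r i = (if i < int v then i else i - 1)" for i
  define l where "l i = (if i = int v then 2 else 1 :: nat)" for i
  define rho where "rho = quasi_ext 0 N (L_runs n) r"
  define t where "t i = (nat (r i + 1), l i)" for i
  have rho: "rho i = r i" if "0 \<le> i" "i < N" for i
    using that by (simp add: rho_def quasi_ext_window)
  have a1: "a i = 1" if "1 \<le> i" "i \<le> n" "i \<noteq> v" for i
    by (rule a(2)) (use that in \<open>auto simp: L_tournament_def\<close>)
  have an: "a n = 1" using v by (intro a1) auto
  have ge1: "1 \<le> a i" if "i \<in> pverts (L_tournament n)" for i
    using a that by (cases "i = v") auto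
  have r: "1 \<le> nat (r i + 1)" "nat (r i + 1) < n" if "0 \<le> i" "i < N" for i
    using that v by (auto simp: r_def N_def)
  have la: "l i \<in> {1..a (nat (r i + 1))}" if "0 \<le> i" "i < N" for i
  proof (cases "i = int v")
    case True
    then show ?thesis using a(1) by (simp add: l_def r_def)
  next
    case False
    then show ?thesis
      using ge1[OF L_vertex[OF r(1)[OF that] less_imp_le[OF r(2)[OF that]]]] by (simp add: l_def)
  qed
  interpret run_numbering N "L_runs n" rho
    unfolding rho_def
    by (rule run_numbering_quasi_ext) (use L_runs[OF n] v in \<open>auto simp: N_def r_def\<close>)
  interpret line_with_apexes N "L_runs n" rho ?B t "(n, 1)" "(n, 1)"
  proof
    show "tournament ?B" by (rule tournament_blowup[OF tournament_L[OF n] ge1])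
    show "pverts ?B = insert (n, 1) (insert (n, 1) (t ` {0..<N}))"
    proof (intro equalityI subsetI)
      fix x assume "x \<in> pverts ?B"
      then obtain i j where x: "x = (i, j)" "1 \<le> i" "i \<le> n" "1 \<le> j" "j \<le> a i"
        by (auto simp: transitive_blowup_def L_tournament_def)
      consider "i = n" | "i = v" "j = 2" | "i < n" "j = 1"
        using x v a(1) a1[of i] by (cases "i = v") force+
      then show "x \<in> insert (n, 1) (insert (n, 1) (t ` {0..<N}))"
      proof cases
        case 1
        then show ?thesis using x an by simp
      next
        case 2
        have "x = t (int v)" using 2 x by (simp add: t_def r_def l_def)
        then show ?thesis using v by (auto simp: N_def)
      next
        case 3
        define i' where "i' = (if i \<le> v then int i - 1 else int i)"
        have "x = t i'" using 3 x by (auto simp: t_def r_def l_def i'_def)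
        moreover have "i' \<in> {0..<N}" using 3 x by (auto simp: i'_def N_def)
        ultimately show ?thesis by blast
      qed
    next
      fix x assume "x \<in> insert (n, 1) (insert (n, 1) (t ` {0..<N}))"
      then consider "x = (n, 1)" | i where "x = t i" "0 \<le> i" "i < N" by auto
      then show "x \<in> pverts ?B"
      proof cases
        case 1
        then show ?thesis using an n by (simp add: transitive_blowup_def L_tournament_def)
      next
        case (2 i)
        then show ?thesis
          using la[of i] r[of i] by (auto simp: t_def transitive_blowup_def L_tournament_def)
      qed
    qed
    show "inj_on t {0..<N}" by (auto simp: inj_on_def t_def r_def l_def split: if_splits)
    show "(n, 1) \<notin> t ` {0..<N}" using r by (force simp: t_def)
    show "(t i, t j) \<in> parcs ?B" if ij: "0 \<le> i" "i < j" "j < N" for i j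
    proof -
      have i: "0 \<le> i" "i < N" and j: "0 \<le> j" "j < N" using ij by auto
      have "(nat (r i + 1), nat (r j + 1)) \<in> parcs (L_tournament n)
          \<or> nat (r i + 1) = nat (r j + 1) \<and> l i < l j"
      proof (cases "r i < r j")
        case True
        then show ?thesis using r[OF i] r[OF j] by (intro disjI1 L_arcs(1)[OF n]) auto
      next
        case False
        then have "r i = r j" "j = int v" "i \<noteq> int v"
          using ij by (auto simp: r_def split: if_splits)
        then show ?thesis by (simp add: l_def)
      qed
      then show ?thesis
        unfolding t_def using r[OF i] r[OF j] la[OF i] la[OF j]
        by (subst blowup_arc_iff) (auto intro!: L_vertex)
    qed
    show "((n, 1), t i) \<in> parcs ?B \<longleftrightarrow> even (rho i)" if i: "0 \<le> i" "i < N" for i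
    proof -
      have "((n, 1), t i) \<in> parcs ?B \<longleftrightarrow> (n, nat (r i + 1)) \<in> parcs (L_tournament n)"
        unfolding t_def using r[OF i] la[OF i] an n
        by (subst blowup_arc_iff) (auto intro!: L_vertex)
      also have "\<dots> \<longleftrightarrow> odd (nat (r i + 1))" by (rule L_arcs(2)[OF n r[OF i]])
      also have "\<dots> \<longleftrightarrow> even (rho i)"
        using rho[OF i] r[OF i] by (simp add: even_nat_iff)
      finally show ?thesis .
    qed
  qed simp
  show ?thesis by (rule CR_tournament)
qed

theorem theorem6p2:
  fixes n :: nat
  assumes "2 \<le> n"
  shows "strong_CR_tournament (L_tournament n)"
  unfolding strong_CR_tournament_def
proof (intro conjI allI impI)
  show "CR_tournament (L_tournament n)" by (rule CR_L[OF assms])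
  fix B assume "one_transitive_blowup (L_tournament n) B"
  then obtain a v where v: "v \<in> pverts (L_tournament n)" and a: "a v = 2"
      "\<And>w. w \<in> pverts (L_tournament n) \<Longrightarrow> w \<noteq> v \<Longrightarrow> a w = 1"
    and B: "B = transitive_blowup (L_tournament n) a"
    unfolding one_transitive_blowup_def by blast
  show "CR_tournament B"
  proof (cases "v = n")
    case True
    then show ?thesis unfolding B using a by (intro CR_L_blowup_apex[OF assms]) auto
  next
    case False
    then have "1 \<le> v" "v < n" using v by (auto simp: L_tournament_def)
    then show ?thesis unfolding B using a by (intro CR_L_blowup_line[of v])
  qed
qed

end
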